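(* Let $n\ge2$. Every algebraic $(\mathbb{C}^{n-1},+)$-action $\varphi$ on $\mathbb{C}^n$ such that $\operatorname{codim}\,\mathcal{NL}(\varphi)\ge 2$ is trivial. In particular $\varphi$ is free.
   Context: An algebraic $(\mathbb{C}^p,+)$-action on $\mathbb{C}^n$ is a regular map $\varphi:\mathbb{C}^p\times\mathbb{C}^n\to\mathbb{C}^n$ with $\varphi(0,x)=x$ and $\varphi(u,\varphi(v,x))=\varphi(u+v,x)$. $\varphi$ is free at $x$ if the orbit of $x$ has dimension $p$, and free if it is free at every point of $\mathbb{C}^n$. $\mathcal{NL}(\varphi)$ is the algebraic set of points of $\mathbb{C}^n$ where $\varphi$ is not free (the empty set has codimension $+\infty$). $\varphi$ is trivial if it is conjugate, by a polynomial automorphism of $\mathbb{C}^n$, to the action $\varphi_0(t_1,\dots,t_p;x_1,\dots,x_n)=(x_1+t_1,\dots,x_p+t_p,x_{p+1},\dots,x_n)$. Here $p=n-1$. *)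

theory Defs
  imports "HOL-Analysis.Analysis" "HOL-Library.Extended_Nat"
begin

inductive cpoly_fun :: "(complex^'n \<Rightarrow> complex) \<Rightarrow> bool" where
  const: "cpoly_fun (\<lambda>x. c)"
| coord: "cpoly_fun (\<lambda>x. x $ i)"
| add: "cpoly_fun f \<Longrightarrow> cpoly_fun g \<Longrightarrow> cpoly_fun (\<lambda>x. f x + g x)"
| mult: "cpoly_fun f \<Longrightarrow> cpoly_fun g \<Longrightarrow> cpoly_fun (\<lambda>x. f x * g x)"

definition cpoly_map :: "(complex^'m \<Rightarrow> complex^'n) \<Rightarrow> bool" where
  "cpoly_map F \<longleftrightarrow> (\<forall>i. cpoly_fun (\<lambda>x. F x $ i))"

definition cpoly_automorphism :: "(complex^'n \<Rightarrow> complex^'n) \<Rightarrow> bool" where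
  "cpoly_automorphism F \<longleftrightarrow> cpoly_map F \<and> bij F \<and> cpoly_map (inv F)"

definition zero_set :: "(complex^'n \<Rightarrow> complex) set \<Rightarrow> (complex^'n) set" where
  "zero_set P = {x. \<forall>f\<in>P. f x = 0}"

definition algebraic_set :: "(complex^'n) set \<Rightarrow> bool" where
  "algebraic_set S \<longleftrightarrow> (\<exists>P. (\<forall>f\<in>P. cpoly_fun f) \<and> S = zero_set P)"

definition zariski :: "(complex^'n) topology" where
  "zariski = topology (\<lambda>U. algebraic_set (- U))"

lemma algebraic_set_Un:
  assumes "algebraic_set S" "algebraic_set T"
  shows "algebraic_set (S \<union> T)"
proof -
  obtain P Q where P: "\<forall>f\<in>P. cpoly_fun f" "S = zero_set P"
    and Q: "\<forall>f\<in>Q. cpoly_fun f" "T = zero_set Q"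
    using assms unfolding algebraic_set_def by blast
  let ?R = "{\<lambda>x. f x * g x |f g. f \<in> P \<and> g \<in> Q}"
  have "\<forall>h\<in>?R. cpoly_fun h"
    using P(1) Q(1) by (auto intro: cpoly_fun.mult)
  moreover have "S \<union> T = zero_set ?R"
    unfolding P(2) Q(2) zero_set_def by fastforce
  ultimately show ?thesis
    unfolding algebraic_set_def by blast
qed

lemma algebraic_set_Inter:
  assumes "\<And>S. S \<in> K \<Longrightarrow> algebraic_set S"
  shows "algebraic_set (\<Inter>K)"
proof -
  have "\<forall>S\<in>K. \<exists>P. (\<forall>f\<in>P. cpoly_fun f) \<and> S = zero_set P"
    using assms unfolding algebraic_set_def by blast
  then obtain P where P: "\<forall>S\<in>K. (\<forall>f\<in>P S. cpoly_fun f) \<and> S = zero_set (P S)"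
    by metis
  have "\<Inter>K = (\<Inter>S\<in>K. zero_set (P S))"
    using P by auto
  also have "\<dots> = zero_set (\<Union>S\<in>K. P S)"
    unfolding zero_set_def by auto
  finally show ?thesis
    unfolding algebraic_set_def using P by blast
qed

lemma istopology_zariski: "istopology (\<lambda>U. algebraic_set (- U :: (complex^'n) set))"
  unfolding istopology_def
proof (intro conjI allI impI)
  fix U V :: "(complex^'n) set"
  assume "algebraic_set (- U)" "algebraic_set (- V)"
  then show "algebraic_set (- (U \<inter> V))"
    using algebraic_set_Un by (metis Compl_Int)
next
  fix K :: "(complex^'n) set set"
  assume K: "\<forall>U\<in>K. algebraic_set (- U)"
  have "- \<Union>K = \<Inter>(uminus ` K)" by auto
  then show "algebraic_set (- \<Union>K)"
    using K algebraic_set_Inter[of "uminus ` K"] by auto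
qed

lemma closedin_zariski_iff: "closedin zariski S \<longleftrightarrow> algebraic_set S"
proof -
  have op: "openin zariski U \<longleftrightarrow> algebraic_set (- U)" for U :: "(complex^'a) set"
    unfolding zariski_def by (simp add: istopology_zariski)
  have "algebraic_set ({} :: (complex^'a) set)"
    unfolding algebraic_set_def zero_set_def
    by (rule exI[of _ "{\<lambda>x. 1}"]) (auto intro: cpoly_fun.const)
  then have "openin zariski (UNIV :: (complex^'a) set)"
    by (simp add: op)
  then have "topspace zariski = (UNIV :: (complex^'a) set)"
    using openin_subset by blast
  then show ?thesis
    by (simp add: closedin_def op Compl_eq_Diff_UNIV[symmetric])
qed

definition irreducible_closedin :: "'a topology \<Rightarrow> 'a set \<Rightarrow> bool" where
  "irreducible_closedin X Z \<longleftrightarrow> closedin X Z \<and> Z \<noteq> {} \<and>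
     (\<forall>A B. closedin X A \<and> closedin X B \<and> Z = A \<union> B \<longrightarrow> Z = A \<or> Z = B)"

definition irreducible_chain :: "'a topology \<Rightarrow> nat \<Rightarrow> (nat \<Rightarrow> 'a set) \<Rightarrow> bool" where
  "irreducible_chain X r Z \<longleftrightarrow>
     (\<forall>i\<le>r. irreducible_closedin X (Z i)) \<and> (\<forall>i<r. Z i \<subset> Z (Suc i))"

text \<open>Used below for nonempty spaces only; in \<^typ>\<open>enat\<close> the empty space gets dimension 0.\<close>

definition krull_dim :: "'a topology \<Rightarrow> enat" where
  "krull_dim X = Sup {enat r |r. \<exists>Z. irreducible_chain X r Z}"

text \<open>The codimension of an irreducible closed set is the supremum of the lengths of the chains
  starting at it; in general it is the infimum over the irreducible closed subsets, which is
  \<open>\<infinity>\<close> for the empty set.\<close>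

definition codim :: "'a topology \<Rightarrow> 'a set \<Rightarrow> enat" where
  "codim X Y = (INF W \<in> {W. irreducible_closedin X W \<and> W \<subseteq> Y}.
     Sup {enat r |r. \<exists>Z. irreducible_chain X r Z \<and> Z 0 = W})"

text \<open>Regularity is joint in both arguments: the product of the affine spaces with coordinates
  indexed by \<open>'p\<close> and \<open>'n\<close> is the affine space with coordinates indexed by \<open>'p + 'n\<close>.\<close>

definition algebraic_action :: "(complex^'p \<Rightarrow> complex^'n \<Rightarrow> complex^'n) \<Rightarrow> bool" where
  "algebraic_action \<phi> \<longleftrightarrow>
     cpoly_map (\<lambda>z :: complex^('p + 'n). \<phi> (\<chi> i. z $ Inl i) (\<chi> j. z $ Inr j)) \<and>
     (\<forall>x. \<phi> 0 x = x) \<and>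
     (\<forall>u v x. \<phi> u (\<phi> v x) = \<phi> (u + v) x)"

definition orbit :: "(complex^'p \<Rightarrow> complex^'n \<Rightarrow> complex^'n) \<Rightarrow> complex^'n \<Rightarrow> (complex^'n) set" where
  "orbit \<phi> x = range (\<lambda>t. \<phi> t x)"

definition free_at :: "(complex^'p \<Rightarrow> complex^'n \<Rightarrow> complex^'n) \<Rightarrow> complex^'n \<Rightarrow> bool" where
  "free_at \<phi> x \<longleftrightarrow> krull_dim (subtopology zariski (orbit \<phi> x)) = enat CARD('p)"

definition free_action :: "(complex^'p \<Rightarrow> complex^'n \<Rightarrow> complex^'n) \<Rightarrow> bool" where
  "free_action \<phi> \<longleftrightarrow> (\<forall>x. free_at \<phi> x)"

definition NL :: "(complex^'p \<Rightarrow> complex^'n \<Rightarrow> complex^'n) \<Rightarrow> (complex^'n) set" where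
  "NL \<phi> = {x. \<not> free_at \<phi> x}"

text \<open>An injection \<open>\<iota>\<close> of the index types says which coordinates of the space are the first
  \<open>CARD('p)\<close> ones, in which order.\<close>

definition translation_action ::
    "('p \<Rightarrow> 'n) \<Rightarrow> complex^'p \<Rightarrow> complex^'n \<Rightarrow> complex^'n" where
  "translation_action \<iota> t x =
     (\<chi> j. if j \<in> range \<iota> then x $ j + t $ (inv \<iota> j) else x $ j)"

definition trivial_action ::
    "('p \<Rightarrow> 'n) \<Rightarrow> (complex^'p \<Rightarrow> complex^'n \<Rightarrow> complex^'n) \<Rightarrow> bool" where
  "trivial_action \<iota> \<phi> \<longleftrightarrow>
     (\<exists>\<psi>. cpoly_automorphism \<psi> \<and>
        (\<forall>t x. \<psi> (\<phi> t x) = translation_action \<iota> t (\<psi> x)))"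

end

theory Submission
  imports Defs "HOL-Computational_Algebra.Fundamental_Theorem_Algebra"
begin

text \<open>
  Write \<open>A\<close> for the ring of polynomials in \<open>n\<close> variables and \<open>p = n - 1\<close>. The coordinate axes of the
  group give \<open>p\<close> commuting one-parameter groups acting on \<open>A\<close>; let \<open>B\<close> be the ring of invariants.

  \<^emph>\<open>Invariants.\<close> Fixing the axes one after the other, each step from the functions invariant
  under some axes to those invariant under one more axis either changes nothing or is controlled by a
  local slice, a function \<open>s\<close> that moves to \<open>s + t a\<close> with \<open>a \<noteq> 0\<close> invariant: up to powers of \<open>a\<close>,
  everything is then a polynomial in \<open>s\<close> with more invariant coefficients. Hence at a general point
  the gradients of all functions are spanned by those of \<open>B\<close> together with at most one vector per
  proper step (\<open>gradients_spanned\<close>). As \<open>p < n\<close>, there is a nonconstant invariant. Let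
  \<open>f\<close> be one of least degree.

  \<^emph>\<open>Fibres.\<close> A function is invariant if it divides a nonzero invariant, so by the choice of \<open>f\<close>
  a prime factor \<open>q\<close> of \<open>f - c\<close> equals \<open>f - c\<close> up to a constant. The hypersurface \<open>q = 0\<close> has
  codimension one, so the codimension hypothesis provides a point \<open>x\<close> on it where the action is free.
  The orbit of \<open>x\<close> has dimension \<open>n - 1\<close> and lies in that irreducible hypersurface; therefore every
  polynomial vanishing on the orbit is divisible by \<open>f - c\<close>
  (\<open>fibre_equation_generates_orbit_ideal\<close>). This one statement has two consequences. First,
  an invariant \<open>h\<close> is constant on the orbit, so that \<open>f\<close> divides \<open>h - h(x)\<close> (for \<open>c = 0\<close>), and
  induction gives that \<open>B\<close> consists of the polynomials in \<open>f\<close>. Secondly, consider for a given axis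
  the local slices \<open>s\<close>, invariant under the other axes, that move to \<open>s + t p(f)\<close>; they exist by the
  gradient count. If \<open>p\<close> has a root \<open>c\<close>, then \<open>s\<close> is constant on the orbit above, and dividing
  \<open>s - s(x)\<close> by \<open>f - c\<close> gives a local slice with \<open>p\<close> of smaller degree. So there is one with \<open>p = 1\<close>
  (\<open>slice_exists\<close>).

  \<^emph>\<open>Coordinates.\<close> With such slices \<open>s_j\<close> for all axes, the point \<open>\<phi> (- s(x)) x\<close> depends on the orbit
  of \<open>x\<close> only, so its coordinates are polynomials in \<open>f(x)\<close>. This exhibits \<open>(s, f)\<close> as a system of
  coordinates with polynomial inverse in which the group acts by translation of \<open>s\<close>. In particular
  the fibres of \<open>f\<close> are single orbits, and each of them contains a point where the action is free.

  The algebraic geometry behind this is obtained by elementary means: \<open>A\<close> is factorial, a polynomial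
  vanishing on the zero set of a prime polynomial is a multiple of it, and the Krull dimension is
  compared with the number of algebraically independent functions.
\<close>

section \<open>The coordinate ring of affine space\<close>

text \<open>As the ground field is infinite, polynomial functions are the same as polynomials. Making
  them a type of class \<^class>\<open>idom\<close> gives access to divisibility, \<^const>\<open>prime_elem\<close> and
  \<^const>\<open>irreducible\<close>, and to one-variable polynomials with coefficients in the coordinate ring.\<close>

typedef 'n cpoly = "{f :: complex^'n::finite \<Rightarrow> complex. cpoly_fun f}"
  morphisms ev Abs_cpoly
  by (auto intro: cpoly_fun.const)

setup_lifting type_definition_cpoly

lemma cpoly_fun_ev [simp, intro]: "cpoly_fun (ev f)"
  using ev[of f] by simp

lemma cpoly_eqI: "(\<And>x. ev f x = ev g x) \<Longrightarrow> f = g"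
  by (simp add: ev_inject[symmetric] fun_eq_iff)

text \<open>Restriction to lines reduces questions about values to polynomials in one variable.\<close>

lemma cpoly_fun_along_line:
  assumes "cpoly_fun f"
  shows "\<exists>p. \<forall>t. f (x + t *s v) = poly p t"
  using assms
proof induction
  case (const c)
  then show ?case by (intro exI[of _ "[:c:]"]) simp
next
  case (coord i)
  then show ?case by (intro exI[of _ "[:x $ i, v $ i:]"]) simp
next
  case (add f g)
  then obtain p q where "\<forall>t. f (x + t *s v) = poly p t" "\<forall>t. g (x + t *s v) = poly q t"
    by blast
  then show ?case by (intro exI[of _ "p + q"]) simp
next
  case (mult f g)
  then obtain p q where "\<forall>t. f (x + t *s v) = poly p t" "\<forall>t. g (x + t *s v) = poly q t"
    by blast
  then show ?case by (intro exI[of _ "p * q"]) simp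
qed

lemma cpoly_fun_no_zero_divisors:
  assumes f: "cpoly_fun f" and g: "cpoly_fun g"
    and "f x \<noteq> 0" "g y \<noteq> 0"
  shows "\<exists>z. f z * g z \<noteq> 0"
proof -
  obtain p where p: "\<And>t. f (x + t *s (y - x)) = poly p t"
    using cpoly_fun_along_line[OF f] by blast
  obtain q where q: "\<And>t. g (x + t *s (y - x)) = poly q t"
    using cpoly_fun_along_line[OF g] by blast
  have "poly p 0 \<noteq> 0" using p[of 0] assms by simp
  moreover have "poly q 1 \<noteq> 0" using q[of 1] assms by simp
  ultimately have "p * q \<noteq> 0" by auto
  then obtain t where "poly (p * q) t \<noteq> 0"
    by (metis poly_all_0_iff_0)
  then show ?thesis using p q by (metis poly_mult)
qed

instantiation cpoly :: (finite) idom
begin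

lift_definition zero_cpoly :: "'a cpoly" is "\<lambda>_. 0" by (rule cpoly_fun.const)
lift_definition one_cpoly :: "'a cpoly" is "\<lambda>_. 1" by (rule cpoly_fun.const)
lift_definition plus_cpoly :: "'a cpoly \<Rightarrow> 'a cpoly \<Rightarrow> 'a cpoly"
  is "\<lambda>f g x. f x + g x" by (rule cpoly_fun.add)
lift_definition times_cpoly :: "'a cpoly \<Rightarrow> 'a cpoly \<Rightarrow> 'a cpoly"
  is "\<lambda>f g x. f x * g x" by (rule cpoly_fun.mult)
lift_definition uminus_cpoly :: "'a cpoly \<Rightarrow> 'a cpoly" is "\<lambda>f x. - f x"
  using cpoly_fun.mult[OF cpoly_fun.const[of "-1"]] by simp
lift_definition minus_cpoly :: "'a cpoly \<Rightarrow> 'a cpoly \<Rightarrow> 'a cpoly" is "\<lambda>f g x. f x - g x"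
  using cpoly_fun.add[OF _ cpoly_fun.mult[OF cpoly_fun.const[of "-1"]]] by simp

instance
proof
  fix a b :: "'a cpoly"
  assume "a \<noteq> 0" "b \<noteq> 0"
  then show "a * b \<noteq> 0"
    by transfer (metis cpoly_fun_no_zero_divisors)
qed (transfer; auto simp: algebra_simps fun_eq_iff)+

end

lift_definition cst :: "complex \<Rightarrow> 'n::finite cpoly" is "\<lambda>c x. c" by (rule cpoly_fun.const)
lift_definition var :: "'n::finite \<Rightarrow> 'n cpoly" is "\<lambda>i x. x $ i" by (rule cpoly_fun.coord)

lemma ev_simps [simp]:
  "ev 0 x = 0" "ev 1 x = 1" "ev (f + g) x = ev f x + ev g x" "ev (f - g) x = ev f x - ev g x"
  "ev (- f) x = - ev f x" "ev (f * g) x = ev f x * ev g x" "ev (cst c) x = c"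
  "ev (var i) x = x $ i"
  by (transfer; simp)+

lemma ev_power [simp]: "ev (f ^ k) x = ev f x ^ k"
  by (induction k) auto

lemma ev_sum [simp]: "ev (sum f I) x = (\<Sum>i\<in>I. ev (f i) x)"
  by (induction I rule: infinite_finite_induct) auto

lemma cst_simps:
  "cst 0 = 0" "cst 1 = 1" "cst (a + b) = cst a + cst b" "cst (a * b) = cst a * cst b"
  "cst (a ^ k) = cst a ^ k" "cst (- a) = - cst a" "cst (a - b) = cst a - cst b"
  by (auto intro!: cpoly_eqI)

lemma cst_eq_iff [simp]: "cst a = cst b \<longleftrightarrow> a = b" "cst a = 0 \<longleftrightarrow> a = 0"
  by (metis ev_simps(7), metis ev_simps(7) cst_simps(1))

lemma cpoly_neq_0_iff: "f \<noteq> 0 \<longleftrightarrow> (\<exists>x. ev f x \<noteq> 0)"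
  by (metis cpoly_eqI ev_simps(1))

lemma cpoly_of_fun:
  assumes "cpoly_fun f"
  obtains g where "ev g = f"
  using Abs_cpoly_inverse[of f] assms by auto

lemma cpoly_induct [case_names const var add mult]:
  fixes f :: "'n::finite cpoly"
  assumes "\<And>c. P (cst c)" "\<And>i. P (var i)"
    "\<And>f g. P f \<Longrightarrow> P g \<Longrightarrow> P (f + g)" "\<And>f g. P f \<Longrightarrow> P g \<Longrightarrow> P (f * g)"
  shows "P f"
proof -
  have "\<exists>h. ev h = F \<and> P h" if "cpoly_fun F" for F :: "complex^'n \<Rightarrow> complex"
    using that
  proof induction
    case (const c)
    then show ?case using assms(1) by (intro exI[of _ "cst c"]) auto
  next
    case (coord i)
    then show ?case using assms(2) by (intro exI[of _ "var i"]) auto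
  next
    case (add F G)
    then obtain f g where "ev f = F" "P f" "ev g = G" "P g" by blast
    then show ?case using assms(3) by (intro exI[of _ "f + g"]) auto
  next
    case (mult F G)
    then obtain f g where "ev f = F" "P f" "ev g = G" "P g" by blast
    then show ?case using assms(4) by (intro exI[of _ "f * g"]) auto
  qed
  from this[OF cpoly_fun_ev[of f]] show ?thesis by (metis ev_inject)
qed

text \<open>Evaluation of the coefficients at a point is a ring homomorphism, and all points together
  separate polynomials over the coordinate ring; so identities can be checked over the complex
  numbers.\<close>

abbreviation ev_coeffs :: "'n::finite cpoly poly \<Rightarrow> complex^'n \<Rightarrow> complex poly" where
  "ev_coeffs P x \<equiv> map_poly (\<lambda>c. ev c x) P"

lemma coeff_ev_coeffs [simp]: "coeff (ev_coeffs P x) k = ev (coeff P k) x"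
  by (simp add: coeff_map_poly)

lemma ev_coeffs_simps [simp]:
  "ev_coeffs (P + Q) x = ev_coeffs P x + ev_coeffs Q x"
  "ev_coeffs (P - Q) x = ev_coeffs P x - ev_coeffs Q x"
  "ev_coeffs (P * Q) x = ev_coeffs P x * ev_coeffs Q x"
  "ev_coeffs (pCons a P) x = pCons (ev a x) (ev_coeffs P x)"
  by (auto simp: poly_eq_iff coeff_mult coeff_pCons split: nat.split)

lemma ev_poly: "ev (poly P g) x = poly (ev_coeffs P x) (ev g x)"
  by (induction P) auto

lemma ev_coeffs_eqI: "(\<And>x. ev_coeffs P x = ev_coeffs Q x) \<Longrightarrow> P = Q"
  by (metis (no_types) coeff_ev_coeffs cpoly_eqI poly_eq_iff)

section \<open>Expansion in one variable\<close>

definition upd :: "complex^'n \<Rightarrow> 'n \<Rightarrow> complex \<Rightarrow> complex^'n" where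
  "upd x i t = (\<chi> j. if j = i then t else x $ j)"

lemma upd_nth [simp]: "upd x i t $ j = (if j = i then t else x $ j)"
  by (simp add: upd_def)

lemma upd_commute: "i \<noteq> j \<Longrightarrow> upd (upd x i t) j s = upd (upd x j s) i t"
  by (auto simp: vec_eq_iff)

text \<open>The subring of polynomials that involve only the variables with index in \<open>S\<close>. Inductions on
  the number of variables run over these subrings, because the number of variables of the ring itself
  is fixed by its type.\<close>

definition in_vars :: "'n::finite set \<Rightarrow> 'n cpoly set" where
  "in_vars S = {f. \<forall>i x t. i \<notin> S \<longrightarrow> ev f (upd x i t) = ev f x}"

lemma in_varsD: "f \<in> in_vars S \<Longrightarrow> i \<notin> S \<Longrightarrow> ev f (upd x i t) = ev f x"
  by (auto simp: in_vars_def)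

lemma in_vars_UNIV [simp]: "f \<in> in_vars UNIV"
  by (simp add: in_vars_def)

lemma in_vars_closed [intro]:
  "0 \<in> in_vars S" "1 \<in> in_vars S" "cst c \<in> in_vars S"
  "f \<in> in_vars S \<Longrightarrow> g \<in> in_vars S \<Longrightarrow> f + g \<in> in_vars S"
  "f \<in> in_vars S \<Longrightarrow> g \<in> in_vars S \<Longrightarrow> f - g \<in> in_vars S"
  "f \<in> in_vars S \<Longrightarrow> g \<in> in_vars S \<Longrightarrow> f * g \<in> in_vars S"
  "f \<in> in_vars S \<Longrightarrow> f ^ k \<in> in_vars S"
  "i \<in> S \<Longrightarrow> var i \<in> in_vars S"
  by (auto simp: in_vars_def)

lemma in_vars_sum [intro]: "(\<And>k. k \<in> I \<Longrightarrow> f k \<in> in_vars S) \<Longrightarrow> sum f I \<in> in_vars S"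
  by (auto simp: in_vars_def intro!: sum.cong)

lemma in_vars_mono: "S \<subseteq> T \<Longrightarrow> f \<in> in_vars S \<Longrightarrow> f \<in> in_vars T"
  by (auto simp: in_vars_def)

lemma in_vars_empty:
  fixes f :: "'n::finite cpoly"
  assumes "f \<in> in_vars {}"
  shows "\<exists>c. f = cst c"
proof -
  have "ev f x = ev f 0" for x
  proof -
    have "ev f (\<chi> j. if j \<in> J then x $ j else 0) = ev f 0" if "finite J" for J :: "'n set"
      using that
    proof induction
      case empty
      then show ?case by (simp add: zero_vec_def[symmetric])
    next
      case (insert i J)
      have "(\<chi> j. if j \<in> insert i J then x $ j else 0)
          = upd (\<chi> j. if j \<in> J then x $ j else 0) i (x $ i)"
        using insert by (auto simp: vec_eq_iff)
      then show ?case using insert in_varsD[OF assms, of i] by simp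
    qed
    from this[of UNIV] show ?thesis by simp
  qed
  then have "f = cst (ev f 0)" by (intro cpoly_eqI) simp
  then show ?thesis by blast
qed

definition over_vars :: "'n::finite set \<Rightarrow> 'n cpoly poly \<Rightarrow> bool" where
  "over_vars S P \<longleftrightarrow> (\<forall>k. coeff P k \<in> in_vars S)"

lemma over_vars_closed:
  "over_vars S 0" "c \<in> in_vars S \<Longrightarrow> over_vars S [:c:]"
  "over_vars S P \<Longrightarrow> over_vars S Q \<Longrightarrow> over_vars S (P + Q)"
  "over_vars S P \<Longrightarrow> over_vars S Q \<Longrightarrow> over_vars S (P - Q)"
  "over_vars S P \<Longrightarrow> over_vars S Q \<Longrightarrow> over_vars S (P * Q)"
  "c \<in> in_vars S \<Longrightarrow> over_vars S (monom c k)"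
  by (auto simp: over_vars_def coeff_mult coeff_pCons split: nat.splits)

text \<open>Changing the \<open>i\<close>-th coordinate does not affect coefficients that are free of \<open>x_i\<close>. So the values
  along that coordinate line determine the coefficients, which makes expansions unique.\<close>

lemma ev_poly_var:
  assumes "over_vars (- {i}) P"
  shows "ev (poly P (var i)) (upd x i t) = poly (ev_coeffs P x) t"
proof -
  have "ev_coeffs P (upd x i t) = ev_coeffs P x"
    using assms by (auto simp: poly_eq_iff over_vars_def intro!: in_varsD)
  then show ?thesis by (simp add: ev_poly)
qed

lemma expansion_unique:
  assumes "over_vars (- {i}) P" "over_vars (- {i}) Q" "poly P (var i) = poly Q (var i)"
  shows "P = Q"
proof (rule ev_coeffs_eqI)
  fix x
  have "poly (ev_coeffs P x) = poly (ev_coeffs Q x)"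
    using ev_poly_var[OF assms(1)] ev_poly_var[OF assms(2)] assms(3) by (metis ext)
  then show "ev_coeffs P x = ev_coeffs Q x" by (simp add: poly_eq_poly_eq_iff)
qed

lemma expansion_exists: "\<exists>P. over_vars (- {i}) P \<and> poly P (var i) = f"
proof (induction f rule: cpoly_induct)
  case (const c)
  then show ?case by (intro exI[of _ "[:cst c:]"]) (auto intro: over_vars_closed)
next
  case (var j)
  show ?case
  proof (cases "i = j")
    case True
    then show ?thesis
      by (intro exI[of _ "monom 1 1"]) (auto intro: over_vars_closed simp: poly_monom)
  next
    case False
    then show ?thesis
      by (intro exI[of _ "[:var j:]"]) (auto intro: over_vars_closed)
  qed
next
  case (add f g)
  then obtain P Q where "over_vars (- {i}) P \<and> poly P (var i) = f"
    "over_vars (- {i}) Q \<and> poly Q (var i) = g" by blast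
  then show ?case by (intro exI[of _ "P + Q"]) (auto intro: over_vars_closed)
next
  case (mult f g)
  then obtain P Q where "over_vars (- {i}) P \<and> poly P (var i) = f"
    "over_vars (- {i}) Q \<and> poly Q (var i) = g" by blast
  then show ?case by (intro exI[of _ "P * Q"]) (auto intro: over_vars_closed)
qed

definition expansion :: "'n::finite \<Rightarrow> 'n cpoly \<Rightarrow> 'n cpoly poly" where
  "expansion i f = (THE P. over_vars (- {i}) P \<and> poly P (var i) = f)"

lemma expansion: "over_vars (- {i}) (expansion i f)" "poly (expansion i f) (var i) = f"
proof -
  have "\<exists>!P. over_vars (- {i}) P \<and> poly P (var i) = f"
    using expansion_exists[of i f] expansion_unique by metis
  from theI'[OF this] show "over_vars (- {i}) (expansion i f)" "poly (expansion i f) (var i) = f"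
    by (simp_all add: expansion_def)
qed

lemma expansionI: "over_vars (- {i}) P \<Longrightarrow> poly P (var i) = f \<Longrightarrow> expansion i f = P"
  using expansion expansion_unique by metis

lemma expansion_simps:
  "expansion i (f + g) = expansion i f + expansion i g"
  "expansion i (f - g) = expansion i f - expansion i g"
  "expansion i (f * g) = expansion i f * expansion i g"
  by (auto intro!: expansionI over_vars_closed expansion simp: expansion)

lemma expansion_const: "c \<in> in_vars (- {i}) \<Longrightarrow> expansion i c = [:c:]"
  by (auto intro!: expansionI over_vars_closed)

lemma expansion_0 [simp]: "expansion i 0 = 0"
  by (auto intro!: expansionI over_vars_closed)

lemma expansion_var_power: "expansion i (var i ^ k) = monom 1 k"
  by (auto intro!: expansionI over_vars_closed simp: poly_monom)

lemma expansion_eq_0_iff [simp]: "expansion i f = 0 \<longleftrightarrow> f = 0"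
  by (metis expansion(2) expansion_0 poly_0)

lemma ev_upd_expansion: "ev f (upd x i t) = poly (ev_coeffs (expansion i f) x) t"
  by (metis ev_poly_var expansion)

text \<open>By uniqueness, an expansion cannot involve a variable on which the function does not depend.\<close>

lemma expansion_over_vars:
  assumes "f \<in> in_vars (insert i S)"
  shows "over_vars (S - {i}) (expansion i f)"
proof -
  have "ev (coeff (expansion i f) k) (upd x j t) = ev (coeff (expansion i f) k) x"
    if "j \<notin> S - {i}" for j k x t
  proof (cases "j = i")
    case True
    then show ?thesis using expansion(1)[of i f] by (auto simp: over_vars_def in_vars_def)
  next
    case False
    then have "j \<notin> insert i S" using that by auto
    have "poly (ev_coeffs (expansion i f) (upd x j t)) s = poly (ev_coeffs (expansion i f) x) s" for s
    proof -
      have "ev f (upd (upd x j t) i s) = ev f (upd x i s)"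
        using in_varsD[OF assms \<open>j \<notin> insert i S\<close>] False by (simp add: upd_commute)
      then show ?thesis by (simp add: ev_upd_expansion)
    qed
    then have "ev_coeffs (expansion i f) (upd x j t) = ev_coeffs (expansion i f) x"
      by (simp add: poly_eq_poly_eq_iff[symmetric] fun_eq_iff)
    then show ?thesis by (metis coeff_ev_coeffs)
  qed
  then show ?thesis by (auto simp: over_vars_def in_vars_def)
qed

definition deg_in :: "'n::finite \<Rightarrow> 'n cpoly \<Rightarrow> nat" where
  "deg_in i f = degree (expansion i f)"

definition lc_in :: "'n::finite \<Rightarrow> 'n cpoly \<Rightarrow> 'n cpoly" where
  "lc_in i f = lead_coeff (expansion i f)"

lemma lc_in_neq_0 [simp]: "lc_in i f = 0 \<longleftrightarrow> f = 0"
  by (simp add: lc_in_def)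

lemma lc_in_in_vars: "f \<in> in_vars (insert i S) \<Longrightarrow> lc_in i f \<in> in_vars (S - {i})"
  using expansion_over_vars by (auto simp: lc_in_def over_vars_def)

lemma lc_in_in_vars': "lc_in i f \<in> in_vars (- {i})"
  using expansion(1) by (auto simp: lc_in_def over_vars_def)

lemma deg_in_mult: "f \<noteq> 0 \<Longrightarrow> g \<noteq> 0 \<Longrightarrow> deg_in i (f * g) = deg_in i f + deg_in i g"
  by (simp add: deg_in_def expansion_simps degree_mult_eq)

lemma deg_in_eq_0_iff: "deg_in i f = 0 \<longleftrightarrow> f \<in> in_vars (- {i})"
proof
  assume "deg_in i f = 0"
  then obtain c where c: "expansion i f = [:c:]"
    unfolding deg_in_def by (metis degree_eq_zeroE)
  with expansion[of i f] show "f \<in> in_vars (- {i})"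
    by (auto simp: over_vars_def dest: spec[of _ 0])
qed (auto simp: deg_in_def expansion_const)

lemma in_vars_iff_deg_in: "f \<in> in_vars S \<longleftrightarrow> (\<forall>i. i \<notin> S \<longrightarrow> deg_in i f = 0)"
  by (auto simp: deg_in_eq_0_iff in_vars_def)

text \<open>Partial degrees are additive, so a variable that occurs in a factor occurs in the product.
  Divisibility of members of the subring therefore means the same in the subring and in the whole ring.\<close>

lemma in_vars_dvd:
  assumes "f * g \<in> in_vars S" "f * g \<noteq> 0"
  shows "f \<in> in_vars S" "g \<in> in_vars S"
  using assms by (auto simp: in_vars_iff_deg_in deg_in_mult)

text \<open>This serves as the degree: it is additive because the partial degrees are, and it vanishes on
  constants only, which are the units.\<close>

definition mdeg :: "'n::finite cpoly \<Rightarrow> nat" where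
  "mdeg f = (\<Sum>i\<in>UNIV. deg_in i f)"

lemma mdeg_mult: "f \<noteq> 0 \<Longrightarrow> g \<noteq> 0 \<Longrightarrow> mdeg (f * g) = mdeg f + mdeg g"
  by (simp add: mdeg_def deg_in_mult sum.distrib)

lemma mdeg_eq_0_iff: "mdeg f = 0 \<longleftrightarrow> (\<exists>c. f = cst c)"
proof
  assume "mdeg f = 0"
  then have "f \<in> in_vars {}" by (simp add: mdeg_def in_vars_iff_deg_in)
  then show "\<exists>c. f = cst c" by (rule in_vars_empty)
next
  assume "\<exists>c. f = cst c"
  then obtain c where f: "f = cst c" by blast
  have "f \<in> in_vars {}" unfolding f by (rule in_vars_closed)
  then show "mdeg f = 0" by (simp add: mdeg_def in_vars_iff_deg_in)
qed

lemma mdeg_diff_cst: "mdeg (f - cst c) \<le> mdeg f"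
  unfolding mdeg_def deg_in_def
  by (intro sum_mono)
     (metis degree_diff_le degree_pCons_0 expansion_const expansion_simps(2) in_vars_closed(3)
        le_refl zero_le)

lemma is_unit_cpoly_iff: "f dvd 1 \<longleftrightarrow> f \<noteq> 0 \<and> mdeg f = 0"
proof
  assume "f dvd 1"
  then obtain g where g: "1 = f * g" by (auto elim: dvdE)
  then have "f \<noteq> 0" "g \<noteq> 0" by auto
  moreover have "mdeg (1 :: 'a cpoly) = 0"
    by (metis cst_simps(2) mdeg_eq_0_iff)
  ultimately show "f \<noteq> 0 \<and> mdeg f = 0" using g mdeg_mult[of f g] by simp
next
  assume f: "f \<noteq> 0 \<and> mdeg f = 0"
  then obtain c where c: "f = cst c" "c \<noteq> 0" by (auto simp: mdeg_eq_0_iff)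
  then have "1 = f * cst (1 / c)" by (simp flip: cst_simps)
  then show "f dvd 1" by (rule dvdI)
qed

lemma nonconst_attains_zero:
  assumes "mdeg f > 0"
  shows "\<exists>x. ev f x = 0"
proof -
  obtain y where y: "ev f y \<noteq> ev f 0"
  proof (rule ccontr)
    assume "\<not> thesis"
    then have "f = cst (ev f 0)" using that by (intro cpoly_eqI) auto
    then show False using assms mdeg_eq_0_iff by (metis less_numeral_extra(3))
  qed
  obtain p where p: "\<And>t. ev f (0 + t *s y) = poly p t"
    using cpoly_fun_along_line[OF cpoly_fun_ev] by blast
  have "\<not> constant (poly p)"
    using y p[of 0] p[of 1] by (auto simp: constant_def)
  then show ?thesis using fundamental_theorem_of_algebra p by metis
qed

section \<open>Unique factorisation\<close>

lemma lc_in_mult: "lc_in i (f * g) = lc_in i f * lc_in i g"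
  by (simp add: lc_in_def expansion_simps lead_coeff_mult)

lemma lc_in_const: "c \<in> in_vars (- {i}) \<Longrightarrow> lc_in i c = c"
  by (simp add: lc_in_def expansion_const)

text \<open>One step of the division of \<open>f\<close> by \<open>w\<close>, with the leading coefficient of \<open>w\<close> multiplied in
  instead of inverted.\<close>

lemma cancel_leading_term:
  fixes f w :: "'n::finite cpoly"
  assumes "deg_in i w \<le> deg_in i f"
  defines "f' \<equiv> lc_in i w * f - lc_in i f * var i ^ (deg_in i f - deg_in i w) * w"
  shows "f' = 0 \<or> deg_in i f' < deg_in i f"
proof -
  define d where "d = deg_in i f"
  have E: "expansion i f' = smult (lc_in i w) (expansion i f)
      - smult (lc_in i f) (monom 1 (d - deg_in i w) * expansion i w)"
    by (simp add: f'_def d_def expansion_simps expansion_const lc_in_in_vars' expansion_var_power)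
  have dm: "degree (monom 1 (d - deg_in i w) * expansion i w) \<le> d"
    using assms(1) degree_mult_le[of "monom 1 (d - deg_in i w)" "expansion i w"]
      degree_monom_le[of "1::'n cpoly" "d - deg_in i w"]
    by (simp add: d_def deg_in_def)
  have "degree (expansion i f') \<le> d"
    unfolding E using dm
    by (intro degree_diff_le order_trans[OF degree_smult_le]) (auto simp: d_def deg_in_def)
  moreover have "coeff (expansion i f') d = 0"
    using assms(1)
    by (simp add: E d_def coeff_monom_mult lc_in_def deg_in_def)
  ultimately have "expansion i f' = 0 \<or> degree (expansion i f') < d"
    by (rule eq_zero_or_degree_less)
  then show ?thesis by (simp add: deg_in_def d_def)
qed

lemma pseudo_division:
  assumes "f \<in> in_vars T" "w \<in> in_vars T" "w \<noteq> 0" "i \<in> T"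
  shows "\<exists>k u r. u \<in> in_vars T \<and> r \<in> in_vars T \<and> lc_in i w ^ k * f = w * u + r \<and>
    (r = 0 \<or> deg_in i r < deg_in i w)"
  using assms(1)
proof (induction "deg_in i f" arbitrary: f rule: less_induct)
  case less
  have lcT: "lc_in i g \<in> in_vars T" if "g \<in> in_vars T" for g
    using lc_in_in_vars[of g i T] that assms(4) by (metis Diff_subset in_vars_mono insert_absorb)
  show ?case
  proof (cases "deg_in i w \<le> deg_in i f")
    case False
    then show ?thesis using less.prems
      by (intro exI[of _ 0] exI[of _ "0::'a cpoly"] exI[of _ f]) auto
  next
    case True
    define m where "m = lc_in i f * var i ^ (deg_in i f - deg_in i w)"
    define f' where "f' = lc_in i w * f - m * w"
    have m: "m \<in> in_vars T" using less.prems assms(4) by (auto simp: m_def intro!: lcT)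
    then have f'T: "f' \<in> in_vars T" using less.prems assms(2) by (auto simp: f'_def intro!: lcT)
    have "f' = 0 \<or> deg_in i f' < deg_in i f"
      using cancel_leading_term[OF True] by (simp add: f'_def m_def)
    then have "\<exists>k u r. u \<in> in_vars T \<and> r \<in> in_vars T \<and> lc_in i w ^ k * f' = w * u + r \<and>
      (r = 0 \<or> deg_in i r < deg_in i w)"
    proof
      assume "f' = 0"
      then show ?thesis
        by (intro exI[of _ 0] exI[of _ "0::'a cpoly"]) auto
    qed (use less.hyps f'T in blast)
    then obtain k u r where *: "u \<in> in_vars T" "r \<in> in_vars T"
      "lc_in i w ^ k * f' = w * u + r" "r = 0 \<or> deg_in i r < deg_in i w" by blast
    have "lc_in i w ^ Suc k * f = lc_in i w ^ k * f' + lc_in i w ^ k * m * w"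
      by (simp add: f'_def algebra_simps)
    also have "\<dots> = w * (u + lc_in i w ^ k * m) + r"
      using *(3) by (simp add: algebra_simps)
    finally have "lc_in i w ^ Suc k * f = w * (u + lc_in i w ^ k * m) + r" .
    moreover have "u + lc_in i w ^ k * m \<in> in_vars T"
      using * m by (intro in_vars_closed lcT assms)
    ultimately show ?thesis using * by blast
  qed
qed

text \<open>This replaces the greatest common divisor of \<open>f\<close> and \<open>g\<close> over the fraction field of the
  coefficients: a nonzero element \<open>w\<close> of the ideal \<open>(f, g)\<close> of least degree in \<open>x_i\<close> divides \<open>f\<close> and
  \<open>g\<close> up to a power of its leading coefficient, since the remainders belong to the ideal.\<close>

lemma common_pseudo_divisor:
  assumes "f \<in> in_vars T" "g \<in> in_vars T" "f \<noteq> 0" "i \<in> T"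
  obtains w p q u v k where "w \<noteq> 0" "w \<in> in_vars T" "w = p * f + q * g"
    "u \<in> in_vars T" "v \<in> in_vars T" "lc_in i w ^ k * f = w * u" "lc_in i w ^ k * g = w * v"
proof -
  define J where "J = {p * f + q * g |p q. p \<in> in_vars T \<and> q \<in> in_vars T}"
  have JT: "J \<subseteq> in_vars T" using assms by (auto simp: J_def)
  have fJ: "f \<in> J" unfolding J_def
    by (rule CollectI, rule exI[of _ 1], rule exI[of _ 0]) auto
  have gJ: "g \<in> J" unfolding J_def
    by (rule CollectI, rule exI[of _ 0], rule exI[of _ 1]) auto
  have "\<exists>w. (w \<in> J \<and> w \<noteq> 0) \<and> (\<forall>w'. w' \<in> J \<and> w' \<noteq> 0 \<longrightarrow> deg_in i w \<le> deg_in i w')"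
    by (rule ex_has_least_nat) (use fJ assms in auto)
  then obtain w where w: "w \<in> J" "w \<noteq> 0"
    and wmin: "\<And>w'. w' \<in> J \<Longrightarrow> w' \<noteq> 0 \<Longrightarrow> deg_in i w \<le> deg_in i w'" by blast
  obtain p q where pq: "w = p * f + q * g" "p \<in> in_vars T" "q \<in> in_vars T"
    using w(1) by (auto simp: J_def)
  let ?a = "lc_in i w"
  have aT: "?a \<in> in_vars T"
    using lc_in_in_vars[of w i T] w JT assms(4) by (metis Diff_subset in_vars_mono insert_absorb subsetD)
  have div: "\<exists>k u. u \<in> in_vars T \<and> ?a ^ k * e = w * u" if "e \<in> J" for e
  proof -
    obtain k u r where kur: "u \<in> in_vars T" "r \<in> in_vars T" "?a ^ k * e = w * u + r"
      "r = 0 \<or> deg_in i r < deg_in i w"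
      using pseudo_division[OF subsetD[OF JT \<open>e \<in> J\<close>] subsetD[OF JT w(1)] w(2) assms(4)] by blast
    obtain p' q' where pq': "e = p' * f + q' * g" "p' \<in> in_vars T" "q' \<in> in_vars T"
      using \<open>e \<in> J\<close> by (auto simp: J_def)
    have "r = (?a ^ k * p' - u * p) * f + (?a ^ k * q' - u * q) * g"
      using kur(3) unfolding pq'(1) by (simp add: pq(1) algebra_simps)
    then have "r \<in> J" unfolding J_def using pq pq' kur aT by blast
    with wmin kur(4) have "r = 0" by fastforce
    with kur show ?thesis by auto
  qed
  obtain k u where u: "u \<in> in_vars T" "?a ^ k * f = w * u" using div[OF fJ] by blast
  obtain l v where v: "v \<in> in_vars T" "?a ^ l * g = w * v" using div[OF gJ] by blast
  have "?a ^ (k + l) * f = w * (?a ^ l * u)" "?a ^ (k + l) * g = w * (?a ^ k * v)"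
    using u v by (simp_all add: power_add algebra_simps)
  moreover have "?a ^ l * u \<in> in_vars T" "?a ^ k * v \<in> in_vars T" using u v aT by auto
  ultimately show thesis using that[of w p q "?a ^ l * u" "?a ^ k * v" "k + l"] w JT pq by blast
qed

definition prime_in :: "'n::finite set \<Rightarrow> 'n cpoly \<Rightarrow> bool" where
  "prime_in S q \<longleftrightarrow> (\<forall>g\<in>in_vars S. \<forall>h\<in>in_vars S. q dvd g * h \<longrightarrow> q dvd g \<or> q dvd h)"

text \<open>A prime of the coefficient ring stays prime in the polynomial ring: if it divides a product,
  it divides one of the two leading coefficients, and the corresponding leading term can be dropped.\<close>

lemma prime_in_insert:
  assumes q: "q \<in> in_vars S" "prime_in S q" and "i \<notin> S"
  shows "prime_in (insert i S) q"
proof -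
  have qi: "q \<in> in_vars (- {i})" using in_vars_mono[of S "- {i}" q] q(1) \<open>i \<notin> S\<close> by auto
  have S: "insert i S - {i} = S" "S - {i} = S" using \<open>i \<notin> S\<close> by auto
  have lcS: "lc_in i g \<in> in_vars S" if "g \<in> in_vars (insert i S)" for g
    using lc_in_in_vars[OF that] S by simp
  have dvd_lc: "q dvd lc_in i g" if "q dvd g" for g
    using that by (auto elim!: dvdE simp: lc_in_mult lc_in_const[OF qi])
  have reduce: "\<exists>g'. g' \<in> in_vars (insert i S) \<and> q dvd g - g' \<and> (g' = 0 \<or> deg_in i g' < deg_in i g)"
    if g: "g \<in> in_vars (insert i S)" "q dvd lc_in i g" for g
  proof -
    have "lc_in i (1 :: 'a cpoly) = 1" "deg_in i (1 :: 'a cpoly) = 0"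
      using lc_in_const[of 1 i] deg_in_eq_0_iff[of i 1] by auto
    then have "g - lc_in i g * var i ^ deg_in i g = 0 \<or>
        deg_in i (g - lc_in i g * var i ^ deg_in i g) < deg_in i g"
      using cancel_leading_term[of i 1 g] by simp
    moreover have "g - lc_in i g * var i ^ deg_in i g \<in> in_vars (insert i S)"
      using g lcS[OF g(1)] in_vars_mono[of S "insert i S" "lc_in i g"]
      by (intro in_vars_closed) auto
    ultimately show ?thesis using g(2)
      by (intro exI[of _ "g - lc_in i g * var i ^ deg_in i g"]) auto
  qed
  have "q dvd g \<or> q dvd h"
    if "g \<in> in_vars (insert i S)" "h \<in> in_vars (insert i S)" "q dvd g * h" for g h
    using that
  proof (induction "deg_in i g + deg_in i h" arbitrary: g h rule: less_induct)
    case less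
    have "q dvd lc_in i g * lc_in i h"
      using dvd_lc[OF less.prems(3)] by (simp add: lc_in_mult)
    then consider "q dvd lc_in i g" | "q dvd lc_in i h"
      using q(2) lcS less.prems unfolding prime_in_def by blast
    then show ?case
    proof cases
      case 1
      then obtain g' where g': "g' \<in> in_vars (insert i S)" "q dvd g - g'"
        "g' = 0 \<or> deg_in i g' < deg_in i g" using reduce less.prems by blast
      have "q dvd g * h - (g - g') * h" using less.prems g' by (intro dvd_diff) auto
      then have "q dvd g' * h" by (simp add: algebra_simps)
      then have "q dvd g' \<or> q dvd h" using less g' by (cases "g' = 0") auto
      then show ?thesis using g'(2) by (metis dvd_add_right_iff diff_add_cancel)
    next
      case 2
      then obtain h' where h': "h' \<in> in_vars (insert i S)" "q dvd h - h'"
        "h' = 0 \<or> deg_in i h' < deg_in i h" using reduce less.prems by blast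
      have "q dvd g * h - g * (h - h')" using less.prems h' by (intro dvd_diff) auto
      then have "q dvd g * h'" by (simp add: algebra_simps)
      then have "q dvd g \<or> q dvd h'" using less h' by (cases "h' = 0") auto
      then show ?thesis using h'(2) by (metis dvd_add_right_iff diff_add_cancel)
    qed
  qed
  then show ?thesis by (auto simp: prime_in_def)
qed

lemma irreducible_factor_exists:
  assumes "mdeg f > 0"
  shows "\<exists>q. irreducible q \<and> q dvd f"
proof -
  have f: "f \<noteq> 0" using assms by (metis cst_simps(1) less_numeral_extra(3) mdeg_eq_0_iff)
  have "\<exists>q. (q dvd f \<and> mdeg q > 0) \<and> (\<forall>q'. q' dvd f \<and> mdeg q' > 0 \<longrightarrow> mdeg q \<le> mdeg q')"
    by (rule ex_has_least_nat) (use assms in auto)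
  then obtain q where q: "q dvd f" "mdeg q > 0"
    and min: "\<And>q'. q' dvd f \<Longrightarrow> mdeg q' > 0 \<Longrightarrow> mdeg q \<le> mdeg q'" by blast
  have "irreducible q"
  proof (rule irreducibleI)
    show "q \<noteq> 0" using q f by auto
    show "\<not> q dvd 1" using q by (simp add: is_unit_cpoly_iff)
    fix a b assume ab: "q = a * b"
    then have nz: "a \<noteq> 0" "b \<noteq> 0" using \<open>q \<noteq> 0\<close> by auto
    have "mdeg a = 0 \<or> mdeg b = 0"
    proof (rule ccontr)
      assume *: "\<not> (mdeg a = 0 \<or> mdeg b = 0)"
      have "a dvd f" using ab q(1) by (metis dvd_mult_left)
      then have "mdeg q \<le> mdeg a" using min * by auto
      then show False using ab mdeg_mult[OF nz] * by auto
    qed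
    then show "a dvd 1 \<or> b dvd 1" using nz by (auto simp: is_unit_cpoly_iff)
  qed
  with q show ?thesis by blast
qed

text \<open>The form of Gauss' lemma used here: a factor \<open>c\<close> that is free of \<open>x_i\<close> can be split off
  from the two factors of \<open>c f\<close>. The prime factors of \<open>c\<close> are cancelled one at a time.\<close>

lemma distribute_constant_factor:
  fixes f w u :: "'n::finite cpoly"
  assumes prime: "\<And>\<pi>. \<pi> \<in> in_vars S \<Longrightarrow> irreducible \<pi> \<Longrightarrow> prime_in S \<pi>"
    and "i \<notin> S" and c: "c \<in> in_vars S" "c \<noteq> 0" and f: "f \<noteq> 0"
    and w: "w \<in> in_vars (insert i S)" and u: "u \<in> in_vars (insert i S)" and eq: "c * f = w * u"
  shows "\<exists>c1 c2 w' u'. c1 \<in> in_vars S \<and> c2 \<in> in_vars S \<and> c1 \<noteq> 0 \<and> c2 \<noteq> 0 \<and>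
    w = c1 * w' \<and> u = c2 * u' \<and> f = w' * u'"
  using c w u eq
proof (induction "mdeg c" arbitrary: c w u rule: less_induct)
  case less
  show ?case
  proof (cases "mdeg c = 0")
    case True
    then have "c dvd 1" using less.prems by (simp add: is_unit_cpoly_iff)
    then obtain d where d: "1 = c * d" by (auto elim: dvdE)
    have "f = (c * f) * d" using d by (metis mult.commute mult.left_commute mult_1)
    then have "f = w * (d * u)" using less.prems by (simp add: algebra_simps)
    moreover have "u = c * (d * u)" using d by (metis mult.assoc mult_1)
    ultimately show ?thesis using less.prems
      by (intro exI[of _ 1] exI[of _ c] exI[of _ w] exI[of _ "d * u"]) auto
  next
    case False
    then obtain \<pi> c' where \<pi>: "irreducible \<pi>" "c = \<pi> * c'"
      using irreducible_factor_exists by (metis dvdE neq0_conv)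
    have nz: "\<pi> \<noteq> 0" "c' \<noteq> 0" using \<pi> less.prems by auto
    have S: "\<pi> \<in> in_vars S" "c' \<in> in_vars S" using in_vars_dvd[of \<pi> c' S] less.prems \<pi> by auto
    have "mdeg \<pi> > 0" using \<pi>(1) nz by (metis irreducible_def is_unit_cpoly_iff neq0_conv)
    then have smaller: "mdeg c' < mdeg c" using \<pi> nz by (simp add: mdeg_mult)
    have wu: "w \<noteq> 0" "u \<noteq> 0" using less.prems f by auto
    have "prime_in (insert i S) \<pi>" using prime_in_insert prime S \<pi> \<open>i \<notin> S\<close> by blast
    moreover have "\<pi> dvd w * u" using less.prems(5) \<pi>(2) by (metis dvd_triv_left mult.assoc)
    ultimately consider "\<pi> dvd w" | "\<pi> dvd u" using less.prems unfolding prime_in_def by blast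
    then show ?thesis
    proof cases
      case 1
      then obtain w1 where w1: "w = \<pi> * w1" by (auto elim: dvdE)
      have eq: "c' * f = w1 * u" using less.prems(5) \<pi>(2) w1 nz by (simp add: mult.assoc)
      have "w1 \<in> in_vars (insert i S)" using in_vars_dvd[of \<pi> w1] w1 wu less.prems by auto
      from less.hyps[OF smaller S(2) nz(2) this less.prems(4) eq]
      obtain c1 c2 w' u' where "c1 \<in> in_vars S" "c2 \<in> in_vars S" "c1 \<noteq> 0" "c2 \<noteq> 0"
        "w1 = c1 * w'" "u = c2 * u'" "f = w' * u'" by blast
      then show ?thesis using w1 S nz
        by (intro exI[of _ "\<pi> * c1"] exI[of _ c2] exI[of _ w'] exI[of _ u']) (auto simp: mult.assoc)
    next
      case 2
      then obtain u1 where u1: "u = \<pi> * u1" by (auto elim: dvdE)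
      have "\<pi> * (c' * f) = \<pi> * (w * u1)" using less.prems(5) \<pi>(2) u1 by (simp add: algebra_simps)
      then have eq: "c' * f = w * u1" using nz by simp
      have "u1 \<in> in_vars (insert i S)" using in_vars_dvd[of \<pi> u1] u1 wu less.prems by auto
      from less.hyps[OF smaller S(2) nz(2) less.prems(3) this eq]
      obtain c1 c2 w' u' where "c1 \<in> in_vars S" "c2 \<in> in_vars S" "c1 \<noteq> 0" "c2 \<noteq> 0"
        "w = c1 * w'" "u1 = c2 * u'" "f = w' * u'" by blast
      then show ?thesis using u1 S nz
        by (intro exI[of _ c1] exI[of _ "\<pi> * c2"] exI[of _ w'] exI[of _ u']) (auto simp: mult.assoc)
    qed
  qed
qed

lemma dvd_unit_cofactor:
  fixes q :: "'a::comm_monoid_mult"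
  assumes "q = a * b" "a dvd 1"
  shows "q dvd b"
proof -
  obtain d where "1 = a * d" using assms(2) by (auto elim: dvdE)
  then have "b = q * d" using assms(1) by (metis mult.commute mult.left_commute mult_1)
  then show ?thesis by (rule dvdI)
qed

lemma dvd_cancel_constant:
  fixes q g :: "'n::finite cpoly"
  assumes prime: "\<And>\<pi>. \<pi> \<in> in_vars S \<Longrightarrow> irreducible \<pi> \<Longrightarrow> prime_in S \<pi>"
    and "i \<notin> S" and c: "c \<in> in_vars S" "c \<noteq> 0"
    and q: "q \<in> in_vars (insert i S)" "irreducible q" "deg_in i q > 0"
    and g: "g \<in> in_vars (insert i S)" "q dvd c * g"
  shows "q dvd g"
proof (cases "g = 0")
  case False
  obtain z where z: "c * g = q * z" using g(2) by (auto elim: dvdE)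
  have cT: "c \<in> in_vars (insert i S)" using in_vars_mono[of S "insert i S" c] c by auto
  have "q * z \<noteq> 0" using z c False by auto
  then have "z \<in> in_vars (insert i S)"
    using in_vars_dvd[of q z "insert i S"] in_vars_closed(6)[OF cT g(1)] z by auto
  from distribute_constant_factor[OF prime \<open>i \<notin> S\<close> c False q(1) this z]
  obtain c1 c2 q' z' where *: "c1 \<in> in_vars S" "q = c1 * q'" "g = q' * z'" by blast
  have "\<not> q' dvd 1"
  proof
    assume "q' dvd 1"
    then have "deg_in i q' = 0"
      by (auto simp: is_unit_cpoly_iff mdeg_def)
    moreover have "deg_in i c1 = 0"
      using * \<open>i \<notin> S\<close> by (simp add: in_vars_iff_deg_in)
    ultimately have "deg_in i q = 0"
      using * q(2) by (metis add_0 deg_in_mult irreducible_def mult_eq_0_iff)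
    then show False using q by simp
  qed
  then have "c1 dvd 1" using q(2) *(2) unfolding irreducible_def by blast
  then show ?thesis using * dvd_unit_cofactor by (metis dvd_mult2)
qed simp

text \<open>Induction on the variables. Suppose that an irreducible \<open>q\<close> involving \<open>x_i\<close> divides \<open>g h\<close>, and
  let \<open>w\<close> be a common pseudo-divisor of \<open>q\<close> and \<open>g\<close>. By Gauss' lemma \<open>w\<close> is, up to a factor free of
  \<open>x_i\<close>, a divisor of \<open>q\<close>. So either \<open>w\<close> is associated with \<open>q\<close>, and then \<open>q\<close> divides \<open>g\<close>; or \<open>w\<close> is
  free of \<open>x_i\<close>, and then \<open>q\<close> divides \<open>w h\<close>, because \<open>w\<close> is a combination of \<open>q\<close> and \<open>g\<close>, and
  hence \<open>h\<close>.\<close>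

lemma irreducible_imp_prime_in:
  fixes S :: "'n::finite set"
  assumes "q \<in> in_vars S" "irreducible q"
  shows "prime_in S q"
proof -
  have "finite S" by simp
  then have "\<forall>q\<in>in_vars S. irreducible q \<longrightarrow> prime_in S q"
  proof (induction S)
    case empty
    show ?case
    proof (intro ballI impI)
      fix q :: "'n cpoly" assume q: "q \<in> in_vars {}" "irreducible q"
      then have "q dvd 1" using in_vars_empty
        by (auto simp: is_unit_cpoly_iff mdeg_eq_0_iff irreducible_def)
      then show "prime_in {} q" using q by (simp add: irreducible_def)
    qed
  next
    case (insert i S)
    have prime: "prime_in S \<pi>" if "\<pi> \<in> in_vars S" "irreducible \<pi>" for \<pi>
      using insert.IH that by blast
    have S: "insert i S - {i} = S" using insert.hyps by auto
    show ?case
    proof (intro ballI impI)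
      fix q assume q: "q \<in> in_vars (insert i S)" "irreducible q"
      have q0: "q \<noteq> 0" using q by (simp add: irreducible_def)
      show "prime_in (insert i S) q"
      proof (cases "deg_in i q = 0")
        case True
        then have "q \<in> in_vars S" using q(1) unfolding in_vars_iff_deg_in by (metis insertE)
        then show ?thesis using prime_in_insert prime q insert.hyps by blast
      next
        case False
        then have qpos: "deg_in i q > 0" by simp
        note cancel = dvd_cancel_constant[OF prime insert.hyps(2) _ _ q qpos]
        show ?thesis unfolding prime_in_def
        proof (intro ballI impI)
          fix g h assume g: "g \<in> in_vars (insert i S)" and h: "h \<in> in_vars (insert i S)"
            and gh: "q dvd g * h"
          obtain w p r u v k where w: "w \<noteq> 0" "w \<in> in_vars (insert i S)" "w = p * q + r * g"
            and uv: "u \<in> in_vars (insert i S)" "v \<in> in_vars (insert i S)"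
            "lc_in i w ^ k * q = w * u" "lc_in i w ^ k * g = w * v"
            using common_pseudo_divisor[OF q(1) g q0, of i] by blast
          let ?c = "lc_in i w ^ k"
          have c: "?c \<in> in_vars S" "?c \<noteq> 0"
            using lc_in_in_vars[OF w(2)] w(1) S by auto
          from distribute_constant_factor[OF prime insert.hyps(2) c q0 w(2) uv(1,3)]
          obtain c1 c2 w' u' where *: "c1 \<in> in_vars S" "c1 \<noteq> 0" "w = c1 * w'" "q = w' * u'"
            by blast
          then consider "w' dvd 1" | "u' dvd 1" using q(2) unfolding irreducible_def by blast
          then show "q dvd g \<or> q dvd h"
          proof cases
            case 1
            then have "w' \<in> in_vars S" by (simp add: is_unit_cpoly_iff mdeg_def in_vars_iff_deg_in)
            then have "w \<in> in_vars S" using * by auto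
            moreover have "w * h = (p * h) * q + r * (g * h)" using w by (simp add: algebra_simps)
            then have "q dvd w * h" using gh by (metis dvd_add dvd_mult dvd_triv_right)
            ultimately show ?thesis using cancel[of w h] w h by blast
          next
            case 2
            then have "q dvd w'" using dvd_unit_cofactor[of q u' w'] * by (simp add: mult.commute)
            then have "q dvd ?c * g" using uv * by simp
            then show ?thesis using cancel[of ?c g] c g by blast
          qed
        qed
      qed
    qed
  qed
  with assms show ?thesis by blast
qed

lemma irreducible_imp_prime_elem_cpoly:
  fixes q :: "'n::finite cpoly"
  assumes "irreducible q"
  shows "prime_elem q"
  using irreducible_imp_prime_in[of q UNIV] assms
  by (auto simp: prime_in_def prime_elem_def irreducible_def)

lemma prime_factor_exists_cpoly:
  fixes f :: "'n::finite cpoly"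
  assumes "mdeg f > 0"
  obtains q where "prime_elem q" "q dvd f"
  using irreducible_factor_exists[OF assms] irreducible_imp_prime_elem_cpoly by blast

section \<open>The zero set of a prime polynomial\<close>

lemma mdeg_prime: "prime_elem q \<Longrightarrow> mdeg q > 0"
  by (metis is_unit_cpoly_iff neq0_conv prime_elem_def)

text \<open>The Nullstellensatz for a hypersurface. Let \<open>q\<close> involve \<open>x_i\<close>, and let \<open>w\<close> be a common
  pseudo-divisor of \<open>q\<close> and \<open>h\<close>. If \<open>q\<close> did not divide \<open>h\<close>, then \<open>w\<close> would be free of \<open>x_i\<close>. But
  \<open>w\<close> vanishes wherever \<open>q\<close> does, and above every point where the leading coefficient of \<open>q\<close> does not
  vanish there is a zero of \<open>q\<close>; so \<open>w\<close> would be zero.\<close>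

theorem prime_dvd_if_vanishes_on_zeros:
  fixes q h :: "'n::finite cpoly"
  assumes q: "prime_elem q" and van: "\<And>x. ev q x = 0 \<Longrightarrow> ev h x = 0"
  shows "q dvd h"
proof -
  have q0: "q \<noteq> 0" using q by auto
  have "\<exists>i. deg_in i q > 0" using mdeg_prime[OF q] by (auto simp: mdeg_def intro: ccontr)
  then obtain i where i: "deg_in i q > 0" by blast
  obtain w p r u v k where w: "w \<noteq> 0" "w = p * q + r * h"
    and uv: "lc_in i w ^ k * q = w * u" "lc_in i w ^ k * h = w * v"
    by (rule common_pseudo_divisor[of q UNIV h i]) (use q0 in auto)
  let ?a = "lc_in i w"
  have a: "?a \<noteq> 0" "?a \<in> in_vars (- {i})" using w lc_in_in_vars' by auto
  have "q dvd w * u" using uv(1) by (metis dvd_triv_right)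
  then consider "q dvd w" | "q dvd u" using q by (auto simp: prime_elem_dvd_mult_iff)
  then show ?thesis
  proof cases
    case 1
    then have "q dvd ?a ^ k * h" using uv by simp
    moreover have "\<not> q dvd ?a"
    proof
      assume "q dvd ?a"
      then obtain z where "?a = q * z" by (auto elim: dvdE)
      then have "deg_in i ?a = deg_in i q + deg_in i z" using a by (metis deg_in_mult mult_eq_0_iff)
      then show False using a i deg_in_eq_0_iff by (metis add_is_0 less_numeral_extra(3))
    qed
    ultimately show ?thesis using q by (metis prime_elem_dvd_mult_iff prime_elem_dvd_power)
  next
    case 2
    then obtain z where "u = q * z" by (auto elim: dvdE)
    then have "?a ^ k * q = (w * z) * q" using uv by (simp add: algebra_simps)
    then have "?a ^ k = w * z" using q0 by simp
    moreover have "?a ^ k \<in> in_vars (- {i})" "?a ^ k \<noteq> 0" using a by auto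
    ultimately have wi: "w \<in> in_vars (- {i})" using in_vars_dvd(1) by metis
    have "w * lc_in i q \<noteq> 0" using w q0 by simp
    then obtain x where x: "ev w x \<noteq> 0" "ev (lc_in i q) x \<noteq> 0"
      unfolding cpoly_neq_0_iff by auto
    let ?Q = "ev_coeffs (expansion i q) x"
    have "coeff ?Q (deg_in i q) \<noteq> 0" using x by (simp add: lc_in_def deg_in_def)
    then have "degree ?Q > 0" using i le_degree by (metis less_le_trans)
    then have "\<not> constant (poly ?Q)" by (simp add: constant_degree)
    then obtain t where "poly ?Q t = 0" using fundamental_theorem_of_algebra by blast
    then have "ev q (upd x i t) = 0" by (simp add: ev_upd_expansion)
    then have "ev w (upd x i t) = 0" using van w by simp
    then show ?thesis using x in_varsD[OF wi, of i] by simp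
  qed
qed

section \<open>Irreducible sets and algebraic independence\<close>

definition vanish :: "(complex^'n::finite) set \<Rightarrow> 'n cpoly \<Rightarrow> bool" where
  "vanish Z f \<longleftrightarrow> (\<forall>x\<in>Z. ev f x = 0)"

definition zeros :: "'n::finite cpoly \<Rightarrow> (complex^'n) set" where
  "zeros f = {x. ev f x = 0}"

lemma vanish_zeros: "vanish (zeros f) f"
  by (simp add: vanish_def zeros_def)

lemma vanish_UNIV [simp]: "vanish UNIV f \<longleftrightarrow> f = 0"
  by (metis UNIV_I cpoly_neq_0_iff vanish_def)

text \<open>The vanishing ideal is prime. For closed sets this is irreducibility; orbits and zero sets are
  handled through their ideals.\<close>

definition prime_set :: "(complex^'n::finite) set \<Rightarrow> bool" where
  "prime_set Z \<longleftrightarrow> Z \<noteq> {} \<and> (\<forall>f g. vanish Z (f * g) \<longrightarrow> vanish Z f \<or> vanish Z g)"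

lemma prime_set_UNIV: "prime_set UNIV"
  by (simp add: prime_set_def)

lemma vanish_zeros_prime_iff:
  assumes "prime_elem q"
  shows "vanish (zeros q) h \<longleftrightarrow> q dvd h"
  using prime_dvd_if_vanishes_on_zeros[OF assms, of h]
  by (auto simp: vanish_def zeros_def elim!: dvdE)

lemma prime_set_zeros:
  assumes "prime_elem q"
  shows "prime_set (zeros q)"
proof -
  have "zeros q \<noteq> {}"
    using nonconst_attains_zero[OF mdeg_prime[OF assms]] by (auto simp: zeros_def)
  then show ?thesis
    using assms by (simp add: prime_set_def vanish_zeros_prime_iff prime_elem_dvd_mult_iff)
qed

lemma algebraic_set_iff: "algebraic_set Z \<longleftrightarrow> (\<forall>x. x \<notin> Z \<longrightarrow> (\<exists>f. vanish Z f \<and> ev f x \<noteq> 0))"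
proof
  assume "algebraic_set Z"
  then obtain P where P: "\<forall>f\<in>P. cpoly_fun f" "Z = zero_set P"
    by (auto simp: algebraic_set_def)
  show "\<forall>x. x \<notin> Z \<longrightarrow> (\<exists>f. vanish Z f \<and> ev f x \<noteq> 0)"
  proof (intro allI impI)
    fix x assume "x \<notin> Z"
    then obtain F where F: "F \<in> P" "F x \<noteq> 0" using P by (auto simp: zero_set_def)
    then obtain f where "ev f = F" using P cpoly_of_fun by blast
    then show "\<exists>f. vanish Z f \<and> ev f x \<noteq> 0"
      using F P by (intro exI[of _ f]) (auto simp: vanish_def zero_set_def)
  qed
next
  assume "\<forall>x. x \<notin> Z \<longrightarrow> (\<exists>f. vanish Z f \<and> ev f x \<noteq> 0)"
  then have "Z = zero_set {ev f |f. vanish Z f}"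
    by (auto simp: zero_set_def vanish_def)
  then show "algebraic_set Z"
    unfolding algebraic_set_def by (intro exI[of _ "{ev f |f. vanish Z f}"]) auto
qed

lemma closedin_zeros: "closedin zariski (zeros f)"
  unfolding closedin_zariski_iff algebraic_set_iff
  by (intro allI impI exI[of _ f]) (simp add: vanish_def zeros_def)

lemma prime_set_if_irreducible_closedin:
  assumes "irreducible_closedin (subtopology zariski X) Z"
  shows "prime_set Z"
  unfolding prime_set_def
proof (intro conjI allI impI)
  show "Z \<noteq> {}" using assms by (simp add: irreducible_closedin_def)
  obtain T where T: "closedin zariski T" "Z = T \<inter> X"
    using assms by (auto simp: irreducible_closedin_def closedin_subtopology)
  fix f g assume fg: "vanish Z (f * g)"
  have cl: "closedin (subtopology zariski X) (Z \<inter> zeros h)" for h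
    unfolding closedin_subtopology using T
    by (intro exI[of _ "T \<inter> zeros h"]) (auto intro: closedin_Int closedin_zeros)
  have "Z = (Z \<inter> zeros f) \<union> (Z \<inter> zeros g)"
    using fg by (auto simp: vanish_def zeros_def)
  then have "Z = Z \<inter> zeros f \<or> Z = Z \<inter> zeros g"
    using assms cl unfolding irreducible_closedin_def by blast
  then show "vanish Z f \<or> vanish Z g" by (auto simp: vanish_def zeros_def)
qed

lemma irreducible_closedin_if_prime_set:
  assumes "prime_set Z" "closedin zariski Z"
  shows "irreducible_closedin zariski Z"
  unfolding irreducible_closedin_def
proof (intro conjI allI impI)
  show "closedin zariski Z" "Z \<noteq> {}" using assms by (auto simp: prime_set_def)
  fix A B assume AB: "closedin zariski A \<and> closedin zariski B \<and> Z = A \<union> B"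
  show "Z = A \<or> Z = B"
  proof (rule ccontr)
    assume "\<not> (Z = A \<or> Z = B)"
    then obtain x y where xy: "x \<in> Z" "x \<notin> A" "y \<in> Z" "y \<notin> B" using AB by blast
    then obtain f g where fg: "vanish A f" "ev f x \<noteq> 0" "vanish B g" "ev g y \<noteq> 0"
      using AB unfolding closedin_zariski_iff algebraic_set_iff by blast
    then have "vanish Z (f * g)" using AB by (auto simp: vanish_def)
    then show False using assms(1) fg xy unfolding prime_set_def vanish_def by blast
  qed
qed

abbreviation exponents :: "nat \<Rightarrow> nat \<Rightarrow> (nat \<Rightarrow> nat) set" where
  "exponents r N \<equiv> {..<r} \<rightarrow>\<^sub>E {..N}"

text \<open>Algebraic independence of \<open>F 0, \<dots>, F (r - 1)\<close> as functions on \<open>Z\<close>. A polynomial relation is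
  given by its coefficients \<open>c\<close>, indexed by exponent vectors with entries at most \<open>N\<close>.\<close>

definition alg_indep_on :: "(complex^'n::finite) set \<Rightarrow> nat \<Rightarrow> (nat \<Rightarrow> 'n cpoly) \<Rightarrow> bool" where
  "alg_indep_on Z r F \<longleftrightarrow> (\<forall>N c.
     vanish Z (\<Sum>\<alpha>\<in>exponents r N. cst (c \<alpha>) * (\<Prod>i<r. F i ^ \<alpha> i)) \<longrightarrow>
     (\<forall>\<alpha>\<in>exponents r N. c \<alpha> = 0))"

lemma alg_indep_on_mono: "alg_indep_on Z r F \<Longrightarrow> Z \<subseteq> Z' \<Longrightarrow> alg_indep_on Z' r F"
  unfolding alg_indep_on_def vanish_def by blast

lemma alg_indep_on_0: "Z \<noteq> {} \<Longrightarrow> alg_indep_on Z 0 F"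
  by (auto simp: alg_indep_on_def vanish_def)

text \<open>A polynomial in \<open>r + 1\<close> quantities, sorted by powers of the last one.\<close>

lemma sum_exponents_Suc:
  fixes F :: "nat \<Rightarrow> 'n::finite cpoly"
  shows "(\<Sum>\<alpha>\<in>exponents (Suc r) N. cst (c \<alpha>) * (\<Prod>i<Suc r. F i ^ \<alpha> i)) =
    (\<Sum>j\<le>N. (\<Sum>\<beta>\<in>exponents r N. cst (c (\<beta>(r := j))) * (\<Prod>i<r. F i ^ \<beta> i)) * F r ^ j)"
proof -
  let ?m = "\<lambda>\<alpha>. cst (c \<alpha>) * (\<Prod>i<Suc r. F i ^ \<alpha> i)"
  have E: "exponents (Suc r) N = (\<lambda>(j, \<beta>). \<beta>(r := j)) ` ({..N} \<times> exponents r N)"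
    unfolding lessThan_Suc PiE_insert_eq ..
  have inj: "inj_on (\<lambda>(j, \<beta>). \<beta>(r := j)) ({..N} \<times> exponents r N)"
    by (rule inj_combinator) simp
  have split: "?m (\<beta>(r := j)) = cst (c (\<beta>(r := j))) * (\<Prod>i<r. F i ^ \<beta> i) * F r ^ j" for \<beta> j
  proof -
    have "(\<Prod>i<r. F i ^ (\<beta>(r := j)) i) = (\<Prod>i<r. F i ^ \<beta> i)" by (intro prod.cong) auto
    then show ?thesis by (simp add: mult.assoc)
  qed
  have "sum ?m (exponents (Suc r) N) = (\<Sum>(j, \<beta>)\<in>{..N} \<times> exponents r N. ?m (\<beta>(r := j)))"
    unfolding E by (subst sum.reindex[OF inj]) (simp add: case_prod_unfold comp_def)
  also have "\<dots> = (\<Sum>j\<le>N. \<Sum>\<beta>\<in>exponents r N. ?m (\<beta>(r := j)))"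
    by (simp add: sum.cartesian_product)
  finally show ?thesis unfolding split by (simp only: sum_distrib_right)
qed

text \<open>The transcendence degree grows along inclusions of irreducible sets. A relation on \<open>Z'\<close>, sorted
  by powers of \<open>f\<close>, has a lowest power of \<open>f\<close> in it. This power can be cancelled because the ideal of
  \<open>Z'\<close> is prime, and restricting to \<open>Z\<close>, where \<open>f\<close> vanishes, leaves the lowest coefficient, which is
  a relation on \<open>Z\<close>.\<close>

lemma alg_indep_on_extend:
  assumes indep: "alg_indep_on Z r F" and "Z \<subseteq> Z'" and "prime_set Z'"
    and f: "vanish Z f" "\<not> vanish Z' f"
  shows "alg_indep_on Z' (Suc r) (F(r := f))"
  unfolding alg_indep_on_def
proof (intro allI impI)
  fix N and c :: "(nat \<Rightarrow> nat) \<Rightarrow> complex"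
  define P where "P j = (\<Sum>\<beta>\<in>exponents r N. cst (c (\<beta>(r := j))) * (\<Prod>i<r. F i ^ \<beta> i))" for j
  assume "vanish Z' (\<Sum>\<alpha>\<in>exponents (Suc r) N. cst (c \<alpha>) * (\<Prod>i<Suc r. (F(r := f)) i ^ \<alpha> i))"
  moreover have "(\<Prod>i<r. (F(r := f)) i ^ \<beta> i) = (\<Prod>i<r. F i ^ \<beta> i)" for \<beta>
    by (intro prod.cong) auto
  ultimately have van: "vanish Z' (\<Sum>j\<le>N. P j * f ^ j)"
    unfolding sum_exponents_Suc P_def by simp
  have zero: "\<forall>\<beta>\<in>exponents r N. c (\<beta>(r := j)) = 0" if "j \<le> N" for j
    using that
  proof (induction j rule: less_induct)
    case (less j)
    have "P j' = 0" if "j' < j" for j'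
    proof -
      have "\<forall>\<beta>\<in>exponents r N. c (\<beta>(r := j')) = 0" 
        using less.IH[of j'] less.prems that by linarith
      then show ?thesis unfolding P_def by (intro sum.neutral ballI) (simp only: cst_simps mult_zero_left)
    qed
    then have "(\<Sum>j'\<le>N. P j' * f ^ j') = (\<Sum>j'\<in>{j..N}. P j' * f ^ j')"
      by (intro sum.mono_neutral_right) auto
    also have "\<dots> = f ^ j * (\<Sum>j'\<in>{j..N}. P j' * f ^ (j' - j))"
      unfolding sum_distrib_left
    proof (intro sum.cong refl)
      fix j' assume "j' \<in> {j..N}"
      then have "f ^ j' = f ^ j * f ^ (j' - j)" by (simp flip: power_add)
      then show "P j' * f ^ j' = f ^ j * (P j' * f ^ (j' - j))" by (simp add: algebra_simps)
    qed
    finally have "vanish Z' (f ^ j * (\<Sum>j'\<in>{j..N}. P j' * f ^ (j' - j)))"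
      using van by simp
    moreover have "\<not> vanish Z' (f ^ j)" using f by (auto simp: vanish_def)
    ultimately have *: "vanish Z' (\<Sum>j'\<in>{j..N}. P j' * f ^ (j' - j))"
      using \<open>prime_set Z'\<close> by (auto simp: prime_set_def)
    have "vanish Z (P j)" unfolding vanish_def
    proof
      fix x assume x: "x \<in> Z"
      have "(\<Sum>j'\<in>{j..N}. ev (P j') x * ev f x ^ (j' - j)) = 0"
        using * x \<open>Z \<subseteq> Z'\<close> by (auto simp: vanish_def)
      moreover have "(\<Sum>j'\<in>{j..N}. ev (P j') x * ev f x ^ (j' - j))
          = (\<Sum>j'\<in>{j}. ev (P j') x * ev f x ^ (j' - j))"
        using less.prems f x by (intro sum.mono_neutral_right) (auto simp: vanish_def)
      ultimately show "ev (P j) x = 0" by simp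
    qed
    with indep[unfolded alg_indep_on_def, THEN spec, THEN spec, of "\<lambda>\<beta>. c (\<beta>(r := j))" N]
    show ?case unfolding P_def by (rule mp)
  qed
  have E: "exponents (Suc r) N = (\<lambda>(j, \<beta>). \<beta>(r := j)) ` ({..N} \<times> exponents r N)"
    unfolding lessThan_Suc PiE_insert_eq ..
  show "\<forall>\<alpha>\<in>exponents (Suc r) N. c \<alpha> = 0"
    unfolding E using zero by auto
qed

lemma alg_indep_on_chain:
  assumes "irreducible_chain (subtopology zariski X) r Z"
  shows "\<exists>F. alg_indep_on (Z r) r F"
  using assms
proof (induction r)
  case 0
  then have "Z 0 \<noteq> {}" by (auto simp: irreducible_chain_def irreducible_closedin_def)
  then show ?case using alg_indep_on_0 by blast
next
  case (Suc r)
  then have "irreducible_chain (subtopology zariski X) r Z"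
    by (auto simp: irreducible_chain_def)
  then obtain F where F: "alg_indep_on (Z r) r F" using Suc.IH by blast
  have sub: "Z r \<subset> Z (Suc r)" and irr: "irreducible_closedin (subtopology zariski X) (Z r)"
      "irreducible_closedin (subtopology zariski X) (Z (Suc r))"
    using Suc.prems by (auto simp: irreducible_chain_def)
  obtain T where T: "closedin zariski T" "Z r = T \<inter> X"
    using irr by (auto simp: irreducible_closedin_def closedin_subtopology)
  obtain T' where T': "Z (Suc r) = T' \<inter> X"
    using irr by (auto simp: irreducible_closedin_def closedin_subtopology)
  obtain y where y: "y \<in> Z (Suc r)" "y \<notin> T" using sub T T' by blast
  then obtain f where f: "vanish T f" "ev f y \<noteq> 0"
    using T(1) unfolding closedin_zariski_iff algebraic_set_iff by blast
  have "vanish (Z r) f" "\<not> vanish (Z (Suc r)) f"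
    using f y T by (auto simp: vanish_def)
  then show ?case
    using alg_indep_on_extend[OF F _ prime_set_if_irreducible_closedin[OF irr(2)]] sub by blast
qed

interpretation cpoly_vs: vector_space "\<lambda>c (f :: 'n::finite cpoly). cst c * f"
  by unfold_locales (auto simp: cst_simps algebra_simps)

text \<open>Monomials with bounded partial degrees; their number is a polynomial of degree \<open>n\<close> in the bound.\<close>

definition monomials_upto :: "nat \<Rightarrow> 'n::finite cpoly set" where
  "monomials_upto D = (\<lambda>\<beta>. \<Prod>i\<in>UNIV. var i ^ \<beta> i) ` (UNIV \<rightarrow>\<^sub>E {..D})"

lemma finite_monomials_upto: "finite (monomials_upto D :: 'n::finite cpoly set)"
  unfolding monomials_upto_def by (intro finite_imageI finite_PiE) auto

lemma card_monomials_upto: "card (monomials_upto D :: 'n::finite cpoly set) \<le> (D + 1) ^ CARD('n)"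
proof -
  have "card (monomials_upto D :: 'n cpoly set) \<le> card ((UNIV :: 'n set) \<rightarrow>\<^sub>E {..D})"
    unfolding monomials_upto_def by (intro card_image_le finite_PiE) auto
  also have "\<dots> = (D + 1) ^ CARD('n)" by (subst card_PiE) auto
  finally show ?thesis .
qed

lemma monomials_upto_mono: "D \<le> E \<Longrightarrow> monomials_upto D \<subseteq> monomials_upto E"
  by (force simp: monomials_upto_def)

lemma monomials_upto_mult:
  assumes "f \<in> monomials_upto D" "g \<in> monomials_upto E"
  shows "f * g \<in> monomials_upto (D + E)"
proof -
  from assms obtain \<beta> \<gamma> where "\<beta> \<in> UNIV \<rightarrow>\<^sub>E {..D}" "f = (\<Prod>i\<in>UNIV. var i ^ \<beta> i)"
    "\<gamma> \<in> UNIV \<rightarrow>\<^sub>E {..E}" "g = (\<Prod>i\<in>UNIV. var i ^ \<gamma> i)"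
    by (auto simp: monomials_upto_def)
  then have "f * g = (\<Prod>i\<in>UNIV. var i ^ (\<beta> i + \<gamma> i))" "(\<lambda>i. \<beta> i + \<gamma> i) \<in> UNIV \<rightarrow>\<^sub>E {..D + E}"
    by (auto simp: power_add prod.distrib PiE_iff intro!: add_mono)
  then show ?thesis unfolding monomials_upto_def by (rule image_eqI)
qed

lemma span_monomials_mult:
  assumes f: "f \<in> cpoly_vs.span (monomials_upto D)" and g: "g \<in> cpoly_vs.span (monomials_upto E)"
  shows "f * g \<in> cpoly_vs.span (monomials_upto (D + E))"
proof -
  have 1: "m * g \<in> cpoly_vs.span (monomials_upto (D + E))" if m: "m \<in> monomials_upto D" for m
    using g
  proof (induction rule: cpoly_vs.span_induct_alt)
    case base
    then show ?case by (simp add: cpoly_vs.span_zero)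
  next
    case (step c x y)
    have "cst c * (m * x) + m * y \<in> cpoly_vs.span (monomials_upto (D + E))"
      using step monomials_upto_mult[OF m]
      by (intro cpoly_vs.span_add cpoly_vs.span_scale) (auto intro: cpoly_vs.span_base)
    then show ?case by (simp add: algebra_simps)
  qed
  show ?thesis using f
  proof (induction rule: cpoly_vs.span_induct_alt)
    case base
    then show ?case by (simp add: cpoly_vs.span_zero)
  next
    case (step c x y)
    have "cst c * (x * g) + y * g \<in> cpoly_vs.span (monomials_upto (D + E))"
      using step 1 by (intro cpoly_vs.span_add cpoly_vs.span_scale) auto
    then show ?case by (simp add: algebra_simps)
  qed
qed

lemma one_in_monomials_upto: "1 \<in> monomials_upto D"
  unfolding monomials_upto_def by (rule image_eqI[of _ _ "\<lambda>_. 0"]) auto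

lemma span_monomials_mono: "D \<le> E \<Longrightarrow> f \<in> cpoly_vs.span (monomials_upto D) \<Longrightarrow> f \<in> cpoly_vs.span (monomials_upto E)"
  using cpoly_vs.span_mono[OF monomials_upto_mono] by blast

lemma in_span_monomials: "\<exists>D. f \<in> cpoly_vs.span (monomials_upto D)"
proof (induction f rule: cpoly_induct)
  case (const c)
  have "cst c * 1 \<in> cpoly_vs.span (monomials_upto 0)"
    by (intro cpoly_vs.span_scale cpoly_vs.span_base one_in_monomials_upto)
  then show ?case by auto
next
  case (var i)
  have "var i = (\<Prod>j\<in>UNIV. var j ^ (if j = i then 1 else 0))"
    by (subst prod.remove[of _ i]) (auto intro!: prod.neutral)
  then have "var i \<in> monomials_upto 1"
    unfolding monomials_upto_def by (intro image_eqI[of _ _ "\<lambda>j. if j = i then 1 else 0"]) auto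
  then show ?case using cpoly_vs.span_base by blast
next
  case (add f g)
  then obtain D E where "f \<in> cpoly_vs.span (monomials_upto D)" "g \<in> cpoly_vs.span (monomials_upto E)" by blast
  then have "f + g \<in> cpoly_vs.span (monomials_upto (max D E))"
    by (intro cpoly_vs.span_add) (auto intro: span_monomials_mono[rotated])
  then show ?case by blast
next
  case (mult f g)
  then show ?case using span_monomials_mult by blast
qed

lemma span_monomials_power: "f \<in> cpoly_vs.span (monomials_upto D) \<Longrightarrow> f ^ k \<in> cpoly_vs.span (monomials_upto (k * D))"
  by (induction k) (auto intro: cpoly_vs.span_base one_in_monomials_upto span_monomials_mult)

lemma span_monomials_prod:
  assumes "\<And>i. i < r \<Longrightarrow> f i \<in> cpoly_vs.span (monomials_upto D)"
  shows "(\<Prod>i<r. f i) \<in> cpoly_vs.span (monomials_upto (r * D))"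
  using assms
proof (induction r)
  case (Suc r)
  then have "(\<Prod>i<r. f i) * f r \<in> cpoly_vs.span (monomials_upto (r * D + D))"
    by (intro span_monomials_mult) auto
  then show ?case by (simp add: add.commute)
qed (auto intro: cpoly_vs.span_base one_in_monomials_upto)

text \<open>A dimension count. If all \<open>F i\<close> have partial degrees at most \<open>D\<close>, then the \<open>(N + 1)\<^sup>r\<close> monomials
  in them with exponents at most \<open>N\<close> lie in a space of dimension at most \<open>(r N D + 1)\<^sup>n\<close>. For large \<open>N\<close>
  they can be linearly independent only if \<open>r \<le> n\<close>.\<close>

theorem alg_indep_on_imp_le_dim:
  fixes F :: "nat \<Rightarrow> 'n::finite cpoly"
  assumes indep: "alg_indep_on Z r F"
  shows "r \<le> CARD('n)"
proof (rule ccontr)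
  assume "\<not> r \<le> CARD('n)"
  then have r: "Suc CARD('n) \<le> r" by simp
  have ind: "alg_indep_on UNIV r F" using alg_indep_on_mono[OF indep] by simp
  have "\<forall>i. \<exists>D. F i \<in> cpoly_vs.span (monomials_upto D)" using in_span_monomials by (rule allI)
  then obtain d where "\<forall>i. F i \<in> cpoly_vs.span (monomials_upto (d i))" unfolding choice_iff by (elim exE)
  then have d: "F i \<in> cpoly_vs.span (monomials_upto (d i))" for i by (rule spec)
  define D where "D = (\<Sum>i<r. d i)"
  have D: "F i \<in> cpoly_vs.span (monomials_upto D)" if "i < r" for i
    using d[of i] member_le_sum[of i "{..<r}" d] that by (auto simp: D_def intro: span_monomials_mono)
  \<comment> \<open>large enough for \<open>(r N D + 1)\<^sup>n < (N + 1)\<^sup>n\<^sup>+\<^sup>1\<close>, since \<open>r N D + 1 \<le> (N + 1) (r D + 1)\<close>\<close>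
  define N where "N = (r * D + 1) ^ CARD('n)"
  define m where "m \<alpha> = (\<Prod>i<r. F i ^ \<alpha> i)" for \<alpha>
  let ?E = "exponents r N"
  have finE: "finite ?E" by (intro finite_PiE) auto
  have lin: "c \<alpha> = 0" if "(\<Sum>\<alpha>\<in>?E. cst (c \<alpha>) * m \<alpha>) = 0" "\<alpha> \<in> ?E" for c \<alpha>
    using ind[unfolded alg_indep_on_def] that unfolding m_def vanish_UNIV by blast
  have inj: "inj_on m ?E"
  proof (rule inj_onI, rule ccontr)
    fix \<alpha> \<beta> assume ab: "\<alpha> \<in> ?E" "\<beta> \<in> ?E" "m \<alpha> = m \<beta>" "\<alpha> \<noteq> \<beta>"
    let ?c = "\<lambda>\<gamma>. if \<gamma> = \<alpha> then 1 else if \<gamma> = \<beta> then -1 else (0::complex)"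
    have "(\<Sum>\<gamma>\<in>?E. cst (?c \<gamma>) * m \<gamma>) = (\<Sum>\<gamma>\<in>{\<alpha>, \<beta>}. cst (?c \<gamma>) * m \<gamma>)"
      using ab finE by (intro sum.mono_neutral_right) (auto simp: cst_simps)
    also have "\<dots> = 0" using ab by (simp add: cst_simps)
    finally show False using lin[of ?c \<alpha>] ab by simp
  qed
  have span: "m ` ?E \<subseteq> cpoly_vs.span (monomials_upto (r * (N * D)))"
  proof
    fix f assume "f \<in> m ` ?E"
    then obtain \<alpha> where a: "\<alpha> \<in> ?E" "f = m \<alpha>" by blast
    have "F i ^ \<alpha> i \<in> cpoly_vs.span (monomials_upto (N * D))" if "i < r" for i
    proof -
      have "\<alpha> i \<le> N" using a that by auto
      then show ?thesis using span_monomials_mono[OF _ span_monomials_power[OF D[OF that]]] by simp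
    qed
    then show "f \<in> cpoly_vs.span (monomials_upto (r * (N * D)))" unfolding a m_def by (rule span_monomials_prod)
  qed
  have "cpoly_vs.independent (m ` ?E)"
  proof (rule cpoly_vs.independent_if_scalars_zero)
    show "finite (m ` ?E)" using finE by simp
    fix u x assume "(\<Sum>x\<in>m ` ?E. cst (u x) * x) = 0" "x \<in> m ` ?E"
    then show "u x = 0" using lin[of "\<lambda>\<alpha>. u (m \<alpha>)"] by (auto simp: sum.reindex[OF inj])
  qed
  then have "card (m ` ?E) \<le> card (monomials_upto (r * (N * D)) :: 'n cpoly set)"
    using cpoly_vs.independent_span_bound[OF finite_monomials_upto _ span] by blast
  then have "(N + 1) ^ r \<le> (r * (N * D) + 1) ^ CARD('n)"
    using card_monomials_upto[of "r * (N * D)", where 'n = 'n] by (simp add: card_image[OF inj] card_PiE)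
  also have "\<dots> \<le> ((N + 1) * (r * D + 1)) ^ CARD('n)"
    by (intro power_mono) (auto simp: algebra_simps)
  also have "\<dots> < (N + 1) ^ CARD('n) * (N + 1)"
    unfolding power_mult_distrib N_def[symmetric] by simp
  also have "\<dots> \<le> (N + 1) ^ r"
    using power_increasing[OF r, of "N + 1"] by (simp add: mult.commute)
  finally show False by simp
qed

text \<open>If \<open>q\<close> does not divide \<open>h\<close>, then \<open>Z\<close> is contained in the proper closed subset \<open>h = 0\<close> of the
  irreducible hypersurface \<open>q = 0\<close>, which is itself a proper closed subset of the whole space. Two
  extensions of the \<open>n - 1\<close> independent functions on \<open>Z\<close> would give \<open>n + 1\<close> independent polynomials.\<close>

theorem dvd_if_vanishes_on_hypersurface:
  fixes q h :: "'n::finite cpoly"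
  assumes indep: "alg_indep_on Z r F" and r: "Suc r = CARD('n)"
    and q: "prime_elem q" "vanish Z q" and h: "vanish Z h"
  shows "q dvd h"
proof (rule ccontr)
  assume "\<not> q dvd h"
  then have "\<not> vanish (zeros q) h" using vanish_zeros_prime_iff q by blast
  moreover have "Z \<subseteq> zeros q" using q by (auto simp: vanish_def zeros_def)
  ultimately have "alg_indep_on (zeros q) (Suc r) (F(r := h))"
    using alg_indep_on_extend[OF indep _ prime_set_zeros[OF q(1)] h] by blast
  moreover have "\<not> vanish UNIV q" using q by auto
  ultimately have "alg_indep_on UNIV (Suc (Suc r)) ((F(r := h))(Suc r := q))"
    using alg_indep_on_extend[OF _ _ prime_set_UNIV vanish_zeros] by blast
  from alg_indep_on_imp_le_dim[OF this] r show False by simp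
qed

text \<open>An irreducible hypersurface is a maximal proper irreducible closed set: a polynomial of least
  degree vanishing on a larger irreducible set is a multiple of \<open>q\<close>, and the cofactor would
  vanish there as well.\<close>

lemma codim_zeros_le_1:
  assumes q: "prime_elem q" and sub: "zeros q \<subseteq> Y"
  shows "codim zariski Y \<le> 1"
proof -
  have irr: "irreducible_closedin zariski (zeros q)"
    by (intro irreducible_closedin_if_prime_set prime_set_zeros q closedin_zeros)
  have len: "r \<le> 1" if chain: "irreducible_chain zariski r Z" and Z0: "Z 0 = zeros q" for r Z
  proof (rule ccontr)
    assume "\<not> r \<le> 1"
    then have "zeros q \<subset> Z 1" "Z 1 \<subset> Z 2"
      "irreducible_closedin zariski (Z 1)"
      using chain Z0 unfolding irreducible_chain_def
      by (metis One_nat_def Suc_1 less_eq_Suc_le less_le_trans not_less zero_less_one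
        less_Suc_eq not_le order.strict_implies_order)+
    then have Z1: "prime_set (Z 1)" "closedin zariski (Z 1)"
      using prime_set_if_irreducible_closedin[of UNIV "Z 1"] by (auto simp: irreducible_closedin_def)
    obtain y where "y \<notin> Z 1" using \<open>Z 1 \<subset> Z 2\<close> by blast
    then obtain f where "vanish (Z 1) f" "ev f y \<noteq> 0"
      using Z1(2) unfolding closedin_zariski_iff algebraic_set_iff by blast
    then have "vanish (Z 1) f \<and> f \<noteq> 0" by auto
    then obtain h where h: "vanish (Z 1) h" "h \<noteq> 0"
      and min: "\<And>h'. vanish (Z 1) h' \<Longrightarrow> h' \<noteq> 0 \<Longrightarrow> mdeg h \<le> mdeg h'"
      using ex_has_least_nat[of "\<lambda>f. vanish (Z 1) f \<and> f \<noteq> 0" f mdeg] by blast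
    have "vanish (zeros q) h" using h \<open>zeros q \<subset> Z 1\<close> by (auto simp: vanish_def)
    then obtain z where z: "h = q * z" using vanish_zeros_prime_iff[OF q] by (auto elim: dvdE)
    have nz: "q \<noteq> 0" "z \<noteq> 0" using z h by auto
    have "\<not> vanish (Z 1) q" using \<open>zeros q \<subset> Z 1\<close> by (auto simp: vanish_def zeros_def)
    then have "vanish (Z 1) z" using Z1(1) h z by (auto simp: prime_set_def)
    then have "mdeg h \<le> mdeg z" using min nz by blast
    then show False using mdeg_prime[OF q] z mdeg_mult[OF nz] by simp
  qed
  have "codim zariski Y \<le> Sup {enat r |r. \<exists>Z. irreducible_chain zariski r Z \<and> Z 0 = zeros q}"
    unfolding codim_def using irr sub by (intro INF_lower) auto
  also have "\<dots> \<le> 1"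
    using len by (intro Sup_least) (auto simp: one_enat_def)
  finally show ?thesis .
qed

lemma free_at_alg_indep:
  fixes \<phi> :: "complex^'p::finite \<Rightarrow> complex^'n::finite \<Rightarrow> complex^'n"
  assumes "free_at \<phi> x"
  shows "\<exists>F. alg_indep_on (orbit \<phi> x) CARD('p) F"
proof -
  let ?X = "subtopology zariski (orbit \<phi> x)"
  have dim: "Sup {enat r |r. \<exists>Z. irreducible_chain ?X r Z} = enat CARD('p)"
    using assms by (simp add: free_at_def krull_dim_def)
  have "\<exists>r Z. irreducible_chain ?X r Z \<and> CARD('p) \<le> r"
  proof (rule ccontr)
    assume *: "\<not> ?thesis"
    have "Sup {enat r |r. \<exists>Z. irreducible_chain ?X r Z} \<le> enat (CARD('p) - 1)"
    proof (rule Sup_least)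
      fix e assume "e \<in> {enat r |r. \<exists>Z. irreducible_chain ?X r Z}"
      then obtain r Z where "e = enat r" "irreducible_chain ?X r Z" by blast
      moreover from this have "\<not> CARD('p) \<le> r" using * by blast
      ultimately show "e \<le> enat (CARD('p) - 1)" by simp
    qed
    then have "CARD('p) \<le> CARD('p) - 1" unfolding dim by (simp only: enat_ord_simps)
    moreover have "CARD('p) \<noteq> 0" by simp
    ultimately show False by linarith
  qed
  then obtain r Z where "irreducible_chain ?X r Z" "CARD('p) \<le> r" by blast
  then have chain: "irreducible_chain ?X CARD('p) Z"
    by (auto simp: irreducible_chain_def)
  then have "closedin ?X (Z CARD('p))"
    by (auto simp: irreducible_chain_def irreducible_closedin_def)
  then have "Z CARD('p) \<subseteq> orbit \<phi> x" by (auto simp: closedin_subtopology)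
  then show ?thesis using alg_indep_on_chain[OF chain] alg_indep_on_mono by blast
qed

section \<open>Gradients\<close>

instance cpoly :: (finite) ring_char_0
proof
  have "ev (of_nat k) x = of_nat k" for k and x :: "complex^'a"
    by (induction k) auto
  then show "inj (of_nat :: nat \<Rightarrow> 'a cpoly)" by (metis injI of_nat_eq_iff)
qed

lemma ev_of_nat [simp]: "ev (of_nat k) x = of_nat k"
  by (induction k) auto

lemma ev_coeffs_pderiv: "ev_coeffs (pderiv P) x = pderiv (ev_coeffs P x)"
  by (simp add: poly_eq_iff coeff_pderiv del: of_nat_Suc)

text \<open>Formal partial derivatives, so that the product rule is that of one-variable polynomials.\<close>

definition grad :: "'n::finite cpoly \<Rightarrow> complex^'n \<Rightarrow> complex^'n" where
  "grad f x = (\<chi> i. ev (poly (pderiv (expansion i f)) (var i)) x)"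

lemma grad_add: "grad (f + g) x = grad f x + grad g x"
  by (simp add: grad_def vec_eq_iff expansion_simps pderiv_add)

lemma grad_mult: "grad (f * g) x = ev f x *s grad g x + ev g x *s grad f x"
  by (simp add: grad_def vec_eq_iff expansion_simps pderiv_mult expansion)

lemma grad_cst [simp]: "grad (cst c) x = 0"
  by (auto simp: grad_def vec_eq_iff expansion_const in_vars_closed)

lemma grad_0 [simp]: "grad 0 x = 0"
  using grad_cst[of 0 x] by (simp add: cst_simps)

lemma grad_var: "grad (var i) x = axis i 1"
proof -
  have "expansion j (var i) = (if j = i then [:0, 1:] else [:var i:])" for j
    by (auto intro!: expansionI over_vars_closed simp: over_vars_def coeff_pCons split: nat.split)
  then show ?thesis by (auto simp: grad_def vec_eq_iff axis_def pderiv_pCons)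
qed

lemma grad_poly_in_span:
  assumes "\<And>k. grad (coeff Q k) x \<in> vec.span G" "grad s x \<in> vec.span G"
  shows "grad (poly Q s) x \<in> vec.span G"
  using assms(1)
proof (induction Q)
  case (pCons c Q)
  have "grad c x \<in> vec.span G" using pCons.prems[of 0] by simp
  moreover have "grad (poly Q s) x \<in> vec.span G" 
    using pCons.prems[of "Suc _"] by (intro pCons.IH) simp
  ultimately show ?case using assms(2)
    by (simp add: grad_add grad_mult) (intro vec.span_add vec.span_scale)
qed (simp add: vec.span_zero)

text \<open>The gradients of the coordinate functions are the unit vectors.\<close>

lemma gradients_span_card:
  fixes S :: "(complex^'n::finite) set"
  assumes "\<And>f. grad f x \<in> vec.span S" "finite S"
  shows "CARD('n) \<le> card S"
proof -
  have "(cart_basis :: (complex^'n) set) \<subseteq> vec.span S"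
    using assms(1)[of "var _"] by (auto simp: cart_basis_def grad_var)
  then show ?thesis
    using vec.independent_span_bound[OF assms(2) independent_cart_basis] by (simp add: card_cart_basis)
qed

section \<open>Algebraic actions of a vector group\<close>

definition join :: "complex^'p \<Rightarrow> complex^'n \<Rightarrow> complex^('p + 'n)" where
  "join u x = (\<chi> k. case k of Inl i \<Rightarrow> u $ i | Inr j \<Rightarrow> x $ j)"

lemma join_nth [simp]: "join u x $ Inl i = u $ i" "join u x $ Inr j = x $ j"
  by (simp_all add: join_def)

lemma cpoly_fun_join_axis:
  fixes h :: "complex^('p::finite + 'n::finite) \<Rightarrow> complex"
  assumes "cpoly_fun h"
  shows "\<exists>P. \<forall>t x. h (join (axis i t) x) = poly (ev_coeffs P x) t"
  using assms
proof induction
  case (const c)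
  then show ?case by (intro exI[of _ "[:cst c:]"]) simp
next
  case (coord k)
  show ?case
  proof (cases k)
    case (Inl j)
    then show ?thesis
      by (intro exI[of _ "if j = i then [:0, 1:] else 0"]) (auto simp: axis_def)
  next
    case (Inr j)
    then show ?thesis by (intro exI[of _ "[:var j:]"]) auto
  qed
next
  case (add f g)
  then obtain P Q where "\<forall>t x. f (join (axis i t) x) = poly (ev_coeffs P x) t"
    "\<forall>t x. g (join (axis i t) x) = poly (ev_coeffs Q x) t" by blast
  then show ?case by (intro exI[of _ "P + Q"]) simp
next
  case (mult f g)
  then obtain P Q where "\<forall>t x. f (join (axis i t) x) = poly (ev_coeffs P x) t"
    "\<forall>t x. g (join (axis i t) x) = poly (ev_coeffs Q x) t" by blast
  then show ?case by (intro exI[of _ "P * Q"]) simp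
qed

lemma cpoly_fun_compose:
  assumes "cpoly_fun h" "\<And>k. cpoly_fun (\<lambda>x. g x $ k)"
  shows "cpoly_fun (\<lambda>x. h (g x))"
  using assms(1) by induction (auto intro: cpoly_fun.intros assms(2))

lemma coeff_pcompose_shift:
  fixes p :: "complex poly"
  assumes "degree p \<le> m"
  shows "coeff (pcompose p [:s, 1:]) m = coeff p m"
proof (cases "degree p = m")
  case True
  then show ?thesis using lead_coeff_comp[of "[:s, 1:]" p] by (simp add: degree_pcompose)
next
  case False
  then show ?thesis using assms by (simp add: coeff_eq_0 degree_pcompose)
qed

locale vector_group_action =
  fixes \<phi> :: "complex^'p::finite \<Rightarrow> complex^'n::finite \<Rightarrow> complex^'n"
  assumes action: "algebraic_action \<phi>"
begin

lemma act_0 [simp]: "\<phi> 0 x = x" and act_add: "\<phi> u (\<phi> v x) = \<phi> (u + v) x"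
  using action by (auto simp: algebraic_action_def)

lemma cpoly_fun_act: "cpoly_fun (\<lambda>z. \<phi> (\<chi> i. z $ Inl i) (\<chi> j. z $ Inr j) $ k)"
  using action by (auto simp: algebraic_action_def cpoly_map_def)

lemma cpoly_fun_act_compose:
  assumes "\<And>i. cpoly_fun (\<lambda>x. \<sigma> x $ i)" "\<And>j. cpoly_fun (\<lambda>x. \<xi> x $ j)"
  shows "cpoly_fun (\<lambda>x. \<phi> (\<sigma> x) (\<xi> x) $ k)"
proof -
  have "cpoly_fun (\<lambda>x. join (\<sigma> x) (\<xi> x) $ l)" for l
    by (cases l) (auto intro: assms)
  from cpoly_fun_compose[OF cpoly_fun_act this] show ?thesis by simp
qed

text \<open>Along the \<open>i\<close>-th axis of the group, the value of \<open>f\<close> is a polynomial in time whose coefficients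
  are functions of the starting point. The resulting map \<open>flow i\<close> is a ring homomorphism.\<close>

lemma flow_exists: "\<exists>P. \<forall>t x. ev f (\<phi> (axis i t) x) = poly (ev_coeffs P x) t"
proof (induction f rule: cpoly_induct)
  case (const c)
  then show ?case by (intro exI[of _ "[:cst c:]"]) simp
next
  case (var k)
  show ?case using cpoly_fun_join_axis[OF cpoly_fun_act[of k], of i] by simp
next
  case (add f g)
  then obtain P Q where "\<forall>t x. ev f (\<phi> (axis i t) x) = poly (ev_coeffs P x) t"
    "\<forall>t x. ev g (\<phi> (axis i t) x) = poly (ev_coeffs Q x) t" by blast
  then show ?case by (intro exI[of _ "P + Q"]) simp
next
  case (mult f g)
  then obtain P Q where "\<forall>t x. ev f (\<phi> (axis i t) x) = poly (ev_coeffs P x) t"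
    "\<forall>t x. ev g (\<phi> (axis i t) x) = poly (ev_coeffs Q x) t" by blast
  then show ?case by (intro exI[of _ "P * Q"]) simp
qed

definition flow :: "'p \<Rightarrow> 'n cpoly \<Rightarrow> 'n cpoly poly" where
  "flow i f = (SOME P. \<forall>t x. ev f (\<phi> (axis i t) x) = poly (ev_coeffs P x) t)"

lemma ev_flow: "ev f (\<phi> (axis i t) x) = poly (ev_coeffs (flow i f) x) t"
  using someI_ex[OF flow_exists[of f i]] unfolding flow_def by blast

lemma flowI:
  assumes "\<And>t x. ev f (\<phi> (axis i t) x) = poly (ev_coeffs P x) t"
  shows "flow i f = P"
proof (rule ev_coeffs_eqI)
  fix x
  show "ev_coeffs (flow i f) x = ev_coeffs P x"
    using assms ev_flow[of f i] by (simp add: poly_eq_poly_eq_iff[symmetric] fun_eq_iff)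
qed

lemma flow_simps:
  "flow i (f + g) = flow i f + flow i g" "flow i (f - g) = flow i f - flow i g"
  "flow i (f * g) = flow i f * flow i g" "flow i (cst c) = [:cst c:]"
  by (rule flowI, simp only: ev_simps, simp add: ev_flow)+

lemma flow_1 [simp]: "flow i 1 = 1"
  using flow_simps(4)[of i 1] by (simp add: cst_simps)

lemma flow_0 [simp]: "flow i 0 = 0"
  using flow_simps(4)[of i 0] by (simp add: cst_simps)

lemma flow_power: "flow i (f ^ k) = flow i f ^ k"
  by (induction k) (simp_all add: flow_simps)

lemma coeff_flow_0: "coeff (flow i f) 0 = f"
proof (rule cpoly_eqI)
  fix x
  have "axis i (0::complex) = 0" by (simp add: axis_def vec_eq_iff)
  then have "\<phi> (axis i 0) x = x" by (metis act_0)
  then show "ev (coeff (flow i f) 0) x = ev f x"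
    using ev_flow[of f i 0 x] by (simp add: poly_0_coeff_0)
qed

lemma flow_eq_0_iff [simp]: "flow i f = 0 \<longleftrightarrow> f = 0"
  by (metis coeff_flow_0 coeff_0 flow_0)

definition invs :: "'p set \<Rightarrow> 'n cpoly set" where
  "invs J = {f. \<forall>i\<in>J. flow i f = [:f:]}"

lemma invs_iff_degree: "f \<in> invs J \<longleftrightarrow> (\<forall>i\<in>J. degree (flow i f) = 0)"
  by (auto simp: invs_def) (metis coeff_flow_0 coeff_pCons_0 degree_eq_zeroE)

lemma invs_iff: "f \<in> invs J \<longleftrightarrow> (\<forall>i\<in>J. \<forall>t x. ev f (\<phi> (axis i t) x) = ev f x)"
  by (auto simp: invs_def ev_flow intro!: flowI)

lemma invs_insert: "f \<in> invs (insert j J) \<longleftrightarrow> f \<in> invs J \<and> flow j f = [:f:]"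
  by (auto simp: invs_def)

lemma invs_closed [intro]:
  "f \<in> invs J \<Longrightarrow> g \<in> invs J \<Longrightarrow> f + g \<in> invs J" "f \<in> invs J \<Longrightarrow> g \<in> invs J \<Longrightarrow> f - g \<in> invs J"
  "f \<in> invs J \<Longrightarrow> g \<in> invs J \<Longrightarrow> f * g \<in> invs J" "cst c \<in> invs J" "f \<in> invs J \<Longrightarrow> f ^ k \<in> invs J"
  by (auto simp: invs_iff)

text \<open>The degree of the flow in time is additive.\<close>

lemma invs_factorially_closed:
  assumes "f * g \<in> invs J" "f * g \<noteq> 0"
  shows "f \<in> invs J" "g \<in> invs J"
proof -
  have "degree (flow i f) + degree (flow i g) = 0" if "i \<in> J" for i
    using assms that by (simp add: invs_iff_degree flow_simps degree_mult_eq)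
  then show "f \<in> invs J" "g \<in> invs J" by (auto simp: invs_iff_degree)
qed

text \<open>The group is commutative.\<close>

lemma coeff_flow_in_invs:
  assumes "f \<in> invs J"
  shows "coeff (flow j f) k \<in> invs J"
  unfolding invs_iff
proof (intro ballI allI)
  fix i t x assume i: "i \<in> J"
  have "poly (ev_coeffs (flow j f) (\<phi> (axis i t) x)) u = poly (ev_coeffs (flow j f) x) u" for u
  proof -
    have "poly (ev_coeffs (flow j f) (\<phi> (axis i t) x)) u = ev f (\<phi> (axis i t) (\<phi> (axis j u) x))"
      unfolding ev_flow[symmetric] act_add by (simp add: add.commute)
    also have "\<dots> = poly (ev_coeffs (flow j f) x) u"
      using assms i by (simp add: invs_iff ev_flow[symmetric])
    finally show ?thesis .
  qed
  then have "ev_coeffs (flow j f) (\<phi> (axis i t) x) = ev_coeffs (flow j f) x"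
    by (simp add: poly_eq_poly_eq_iff[symmetric] fun_eq_iff)
  then show "ev (coeff (flow j f) k) (\<phi> (axis i t) x) = ev (coeff (flow j f) k) x"
    by (metis coeff_ev_coeffs)
qed

lemma ev_coeffs_flow_act:
  "ev_coeffs (flow j f) (\<phi> (axis j s) x) = pcompose (ev_coeffs (flow j f) x) [:s, 1:]"
proof -
  have "axis j u + axis j s = axis j (s + u)" for u by (simp add: axis_def vec_eq_iff)
  then have "poly (ev_coeffs (flow j f) (\<phi> (axis j s) x)) u
      = poly (pcompose (ev_coeffs (flow j f) x) [:s, 1:]) u" for u
    unfolding ev_flow[symmetric] act_add poly_pcompose by (simp add: ev_flow[symmetric])
  then show ?thesis by (simp add: poly_eq_poly_eq_iff[symmetric] fun_eq_iff)
qed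

text \<open>The linear coefficient of the flow is the derivation generating the one-parameter group. Flowing
  for time \<open>s\<close> first and differentiating at \<open>0\<close> is differentiating at \<open>s\<close>.\<close>

lemma flow_derivation: "flow j (coeff (flow j f) 1) = pderiv (flow j f)"
proof (rule flowI)
  fix s x
  let ?p = "ev_coeffs (flow j f) x"
  have "ev (coeff (flow j f) 1) (\<phi> (axis j s) x) = coeff (pcompose ?p [:s, 1:]) 1"
    using ev_coeffs_flow_act by (metis coeff_ev_coeffs)
  also have "\<dots> = poly (pderiv (pcompose ?p [:s, 1:])) 0"
    by (simp add: poly_0_coeff_0 coeff_pderiv)
  also have "\<dots> = poly (pderiv ?p) s"
    by (simp add: pderiv_pcompose poly_pcompose pderiv_pCons)
  finally show "ev (coeff (flow j f) 1) (\<phi> (axis j s) x) = poly (ev_coeffs (pderiv (flow j f)) x) s"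
    by (simp add: ev_coeffs_pderiv)
qed

lemma flow_lead_coeff: "flow j (lead_coeff (flow j f)) = [:lead_coeff (flow j f):]"
proof (rule flowI)
  fix s x
  let ?p = "ev_coeffs (flow j f) x" and ?m = "degree (flow j f)"
  have "ev (lead_coeff (flow j f)) (\<phi> (axis j s) x) = coeff (pcompose ?p [:s, 1:]) ?m"
    using ev_coeffs_flow_act by (metis coeff_ev_coeffs)
  also have "\<dots> = coeff ?p ?m" by (rule coeff_pcompose_shift) (rule map_poly_degree_leq)
  finally show "ev (lead_coeff (flow j f)) (\<phi> (axis j s) x)
      = poly (ev_coeffs [:lead_coeff (flow j f):] x) s" by simp
qed

text \<open>Take a function that is moved, with flow of least positive degree. Its derivative has flow of
  degree one less, so by minimality the derivative is invariant.\<close>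

lemma local_slice_exists:
  assumes "invs (insert j J) \<noteq> invs J"
  obtains s a where "s \<in> invs J" "a \<in> invs (insert j J)" "a \<noteq> 0" "flow j s = [:s, a:]"
proof -
  have "invs (insert j J) \<subseteq> invs J" by (auto simp: invs_def)
  then obtain b where "b \<in> invs J" "b \<notin> invs (insert j J)" using assms by blast
  then have "b \<in> invs J \<and> degree (flow j b) > 0"
    by (auto simp: invs_iff_degree)
  from ex_has_least_nat[of "\<lambda>b. b \<in> invs J \<and> degree (flow j b) > 0", OF this, of "\<lambda>b. degree (flow j b)"]
  obtain b where b: "b \<in> invs J" "degree (flow j b) > 0"
    and min: "\<And>b'. b' \<in> invs J \<Longrightarrow> degree (flow j b') > 0 \<Longrightarrow> degree (flow j b) \<le> degree (flow j b')"
    by blast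
  define a where "a = coeff (flow j b) 1"
  have aJ: "a \<in> invs J" unfolding a_def by (rule coeff_flow_in_invs[OF b(1)])
  have deg: "degree (flow j a) = degree (flow j b) - 1"
    unfolding a_def flow_derivation by (rule degree_pderiv)
  have "degree (flow j a) = 0" using min[OF aJ] deg b(2) by linarith
  then have d1: "degree (flow j b) = 1" using deg b(2) by linarith
  have "flow j b = [:b, a:]"
    using d1 by (intro poly_eqI)
      (auto simp: a_def coeff_flow_0 coeff_pCons coeff_eq_0 split: nat.split)
  moreover have "a \<noteq> 0" using d1 unfolding a_def by (metis leading_coeff_0_iff degree_0 zero_neq_one)
  moreover have "a \<in> invs (insert j J)"
    using aJ \<open>degree (flow j a) = 0\<close> by (simp add: invs_iff_degree)
  ultimately show thesis using that b(1) by blast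
qed

text \<open>Subtracting \<open>c s\<^sup>m\<close> from \<open>a\<^sup>m b\<close>, where \<open>c\<close> is the leading coefficient and \<open>m\<close> the degree of the flow
  of \<open>b\<close>, cancels the top term of the flow.\<close>

lemma expand_in_local_slice:
  assumes s: "s \<in> invs J" "flow j s = [:s, a:]" and a: "a \<in> invs (insert j J)"
    and b: "b \<in> invs J"
  shows "\<exists>k Q. a ^ k * b = poly Q s \<and> (\<forall>l. coeff Q l \<in> invs (insert j J))"
  using b
proof (induction "degree (flow j b)" arbitrary: b rule: less_induct)
  case less
  have cst0: "0 \<in> invs (insert j J)" using invs_closed(4)[of 0] by (simp add: cst_simps)
  show ?case
  proof (cases "degree (flow j b) = 0")
    case True
    then have "b \<in> invs (insert j J)" using less.prems by (simp add: invs_iff_degree)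
    then show ?thesis using cst0
      by (intro exI[of _ 0] exI[of _ "[:b:]"]) (auto simp: coeff_pCons split: nat.split)
  next
    case False
    define m where "m = degree (flow j b)"
    define c where "c = lead_coeff (flow j b)"
    define b' where "b' = a ^ m * b - c * s ^ m"
    have c: "c \<in> invs (insert j J)"
      using coeff_flow_in_invs[OF less.prems] flow_lead_coeff by (auto simp: invs_insert c_def)
    have aJ: "a \<in> invs J" "c \<in> invs J" and flow_ac: "flow j a = [:a:]" "flow j c = [:c:]"
      using a c by (auto simp: invs_insert)
    have b': "b' \<in> invs J" unfolding b'_def using aJ less.prems s by auto
    have flow_b': "flow j b' = smult (a ^ m) (flow j b) - smult c ([:s, a:] ^ m)"
      by (simp add: b'_def flow_simps flow_power flow_ac s poly_const_pow)
    have degree_power: "degree ([:s, a:] ^ l) \<le> l" for l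
    proof -
      have "degree ([:s, a:] ^ l) \<le> degree [:s, a:] * l" by (rule degree_power_le)
      also have "\<dots> \<le> 1 * l" by (rule mult_le_mono1) simp
      finally show ?thesis by simp
    qed
    then have "degree (flow j b') \<le> m"
      unfolding flow_b' by (intro degree_diff_le order_trans[OF degree_smult_le]) (auto simp: m_def)
    moreover have "coeff ([:s, a:] ^ m) m = a ^ m"
    proof (induction m)
      case (Suc m)
      have "coeff ([:s, a:] ^ m) (Suc m) = 0"
        using degree_power[of m] by (simp add: coeff_eq_0)
      then show ?case using Suc by (simp add: coeff_pCons)
    qed simp
    then have "coeff (flow j b') m = 0"
      by (simp add: flow_b' c_def m_def)
    ultimately have "flow j b' = 0 \<or> degree (flow j b') < m"
      by (rule eq_zero_or_degree_less)
    then have "degree (flow j b') < degree (flow j b)" using False by (auto simp: m_def)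
    from less.hyps[OF this b'] obtain k Q where Q: "a ^ k * b' = poly Q s"
      "\<forall>l. coeff Q l \<in> invs (insert j J)" by blast
    have "a ^ (k + m) * b = poly (Q + monom (a ^ k * c) m) s"
      using Q(1) by (simp add: b'_def poly_monom power_add algebra_simps)
    moreover have "coeff (Q + monom (a ^ k * c) m) l \<in> invs (insert j J)" for l
      using Q(2) a c cst0 by auto
    ultimately show ?thesis by blast
  qed
qed

text \<open>Differentiating the expansion of \<open>a\<^sup>k b\<close> in a local slice \<open>s\<close> expresses the gradient of \<open>b\<close>, where
  \<open>a\<close> does not vanish, by the gradient of \<open>s\<close> and gradients of functions invariant under one more
  axis. The vectors in \<open>T\<close> are the gradients of the local slices, and \<open>h\<close> is the product of the
  corresponding \<open>a\<close>.\<close>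

theorem gradients_spanned:
  "\<exists>h\<noteq>0. \<forall>x. ev h x \<noteq> 0 \<longrightarrow> (\<exists>T. finite T \<and> card T \<le> card J \<and>
     (\<forall>f. grad f x \<in> vec.span ((\<lambda>g. grad g x) ` invs J \<union> T)))"
proof -
  have "finite J" by simp
  then show ?thesis
  proof (induction J)
    case empty
    have "f \<in> invs {}" for f by (simp add: invs_def)
    then show ?case
      by (intro exI[of _ 1]) (auto intro!: exI[of _ "{}"] vec.span_base)
  next
    case (insert j J)
    then obtain h where h: "h \<noteq> 0" and span: "\<And>x. ev h x \<noteq> 0 \<Longrightarrow>
        \<exists>T. finite T \<and> card T \<le> card J \<and> (\<forall>f. grad f x \<in> vec.span ((\<lambda>g. grad g x) ` invs J \<union> T))"
      by blast
    show ?case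
    proof (cases "invs (insert j J) = invs J")
      case True
      have "card J \<le> card (insert j J)" by (rule card_insert_le)
      show ?thesis
      proof (intro exI[of _ h] conjI allI impI)
        fix x assume "ev h x \<noteq> 0"
        from span[OF this] obtain T where "finite T" "card T \<le> card J"
          "\<forall>f. grad f x \<in> vec.span ((\<lambda>g. grad g x) ` invs J \<union> T)" by blast
        then show "\<exists>T. finite T \<and> card T \<le> card (insert j J) \<and>
          (\<forall>f. grad f x \<in> vec.span ((\<lambda>g. grad g x) ` invs (insert j J) \<union> T))"
          unfolding True using \<open>card J \<le> card (insert j J)\<close> by (intro exI[of _ T]) auto
      qed (rule h)
    next
      case False
      then obtain s a where s: "s \<in> invs J" "flow j s = [:s, a:]"
        and a: "a \<in> invs (insert j J)" "a \<noteq> 0"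
        using local_slice_exists by blast
      show ?thesis
      proof (intro exI[of _ "h * a"] conjI allI impI)
        show "h * a \<noteq> 0" using h a by simp
        fix x assume x: "ev (h * a) x \<noteq> 0"
        then obtain T where T: "finite T" "card T \<le> card J"
          "\<And>f. grad f x \<in> vec.span ((\<lambda>g. grad g x) ` invs J \<union> T)"
          using span[of x] by auto
        let ?G = "(\<lambda>g. grad g x) ` invs (insert j J) \<union> insert (grad s x) T"
        have base: "grad g x \<in> vec.span ?G" if "g \<in> invs (insert j J)" for g
          using that by (intro vec.span_base) auto
        have sG: "grad s x \<in> vec.span ?G" by (intro vec.span_base) auto
        have inJ: "grad b x \<in> vec.span ?G" if b: "b \<in> invs J" for b
        proof -
          obtain k Q where Q: "a ^ k * b = poly Q s" "\<forall>l. coeff Q l \<in> invs (insert j J)"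
            using expand_in_local_slice[OF s a(1) b] by blast
          have "grad (a ^ k * b) x \<in> vec.span ?G"
            unfolding Q(1) using Q(2) sG base by (intro grad_poly_in_span) auto
          moreover have "ev b x *s grad (a ^ k) x \<in> vec.span ?G"
            using base[of "a ^ k"] a by (intro vec.span_scale) auto
          ultimately have "grad (a ^ k * b) x - ev b x *s grad (a ^ k) x \<in> vec.span ?G"
            by (rule vec.span_diff)
          then have "(1 / ev (a ^ k) x) *s (ev (a ^ k) x *s grad b x) \<in> vec.span ?G"
            by - (rule vec.span_scale, simp add: grad_mult)
          moreover have "(1 / ev (a ^ k) x) *s (ev (a ^ k) x *s grad b x) = grad b x"
            using x by (simp add: vector_smult_assoc)
          ultimately show ?thesis by metis
        qed
        have "(\<lambda>g. grad g x) ` invs J \<union> T \<subseteq> vec.span ?G"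
          using inJ vec.span_base[of _ ?G] by blast
        then have "vec.span ((\<lambda>g. grad g x) ` invs J \<union> T) \<subseteq> vec.span ?G"
          by (rule vec.span_minimal) (rule vec.subspace_span)
        then have "\<forall>f. grad f x \<in> vec.span ?G" using T(3) by blast
        moreover have "card (insert (grad s x) T) \<le> card (insert j J)"
          using T insert.hyps by (simp add: card_insert_if)
        ultimately show "\<exists>T. finite T \<and> card T \<le> card (insert j J) \<and>
          (\<forall>f. grad f x \<in> vec.span ((\<lambda>g. grad g x) ` invs (insert j J) \<union> T))"
          using T(1) by (intro exI[of _ "insert (grad s x) T"]) auto
      qed
    qed
  qed
qed

text \<open>A function is determined on an orbit by its behaviour along the axes, which are traversed one after
  the other.\<close>

lemma act_shift:
  fixes s a :: "complex^'n \<Rightarrow> complex"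
  assumes s: "\<And>i t x. s (\<phi> (axis i t) x) = s x + (if i = j then t * a x else 0)"
    and a: "\<And>u x. a (\<phi> u x) = a x"
  shows "s (\<phi> u x) = s x + u $ j * a x"
proof -
  have "s (\<phi> (\<chi> i. if i \<in> I then u $ i else 0) x) = s x + (if j \<in> I then u $ j * a x else 0)"
    if "finite I" for I
    using that
  proof induction
    case empty
    then show ?case by (simp add: zero_vec_def[symmetric])
  next
    case (insert k I)
    let ?v = "\<chi> i. if i \<in> I then u $ i else 0"
    have "(\<chi> i. if i \<in> insert k I then u $ i else 0) = axis k (u $ k) + ?v"
      using insert.hyps by (auto simp: vec_eq_iff axis_def)
    then have "s (\<phi> (\<chi> i. if i \<in> insert k I then u $ i else 0) x) = s (\<phi> (axis k (u $ k)) (\<phi> ?v x))"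
      by (simp add: act_add)
    then show ?case using insert s a by auto
  qed
  from this[of UNIV] show ?thesis by simp
qed

lemma invs_UNIV_act:
  assumes "f \<in> invs UNIV"
  shows "ev f (\<phi> u x) = ev f x"
  using act_shift[of "ev f" undefined "\<lambda>_. 0" u x] assms by (simp add: invs_iff)

end

section \<open>Actions that are free outside codimension two\<close>

definition comp_poly :: "complex poly \<Rightarrow> 'n::finite cpoly \<Rightarrow> 'n cpoly" where
  "comp_poly p f = poly (map_poly cst p) f"

lemma cpoly_funI: "(\<And>x. ev g x = h x) \<Longrightarrow> cpoly_fun h"
  by (metis cpoly_fun_ev ext)

lemma comp_poly_pCons: "comp_poly (pCons c p) f = cst c + f * comp_poly p f"
  by (simp add: comp_poly_def map_poly_pCons cst_simps)

lemma comp_poly_0 [simp]: "comp_poly 0 f = 0"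
  by (simp add: comp_poly_def)

lemma ev_comp_poly [simp]: "ev (comp_poly p f) x = poly p (ev f x)"
  by (induction p) (auto simp: comp_poly_pCons)

lemma grad_comp_poly_in_span: "grad (comp_poly p f) x \<in> vec.span {grad f x}"
  unfolding comp_poly_def
  by (rule grad_poly_in_span) (auto simp: coeff_map_poly cst_simps vec.span_zero vec.span_base)

locale almost_free_action = vector_group_action \<phi>
  for \<phi> :: "complex^'p::finite \<Rightarrow> complex^'n::finite \<Rightarrow> complex^'n" +
  assumes card_n: "CARD('n) = Suc CARD('p)"
    and codim_NL: "codim zariski (NL \<phi>) \<ge> 2"
begin

text \<open>Otherwise the invariants contribute no gradients, and \<open>p\<close> vectors would span the \<open>n\<close>-dimensional
  space.\<close>

lemma nonconst_invariant_exists: "\<exists>f. f \<in> invs UNIV \<and> mdeg f > 0"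
proof (rule ccontr)
  assume "\<not> ?thesis"
  then have const: "grad g x = 0" if "g \<in> invs UNIV" for g x
    using that mdeg_eq_0_iff[of g] by fastforce
  obtain h where h: "h \<noteq> 0" "\<And>x. ev h x \<noteq> 0 \<Longrightarrow> \<exists>T. finite T \<and> card T \<le> card (UNIV :: 'p set) \<and>
     (\<forall>f. grad f x \<in> vec.span ((\<lambda>g. grad g x) ` invs UNIV \<union> T))"
    using gradients_spanned[of UNIV] by blast
  obtain x where "ev h x \<noteq> 0" using h(1) by (auto simp: cpoly_neq_0_iff)
  with h(2) obtain T where T: "finite T" "card T \<le> CARD('p)"
    "\<And>f. grad f x \<in> vec.span ((\<lambda>g. grad g x) ` invs UNIV \<union> T)" by blast
  have "(\<lambda>g. grad g x) ` invs UNIV \<union> T \<subseteq> vec.span T"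
    using const vec.span_base[of _ T] by (auto simp: vec.span_zero)
  then have "vec.span ((\<lambda>g. grad g x) ` invs UNIV \<union> T) \<subseteq> vec.span T"
    by (rule vec.span_minimal) (rule vec.subspace_span)
  then have "CARD('n) \<le> card T" using gradients_span_card[OF _ T(1)] T(3) by blast
  then show False using T(2) card_n by simp
qed

definition minimal_invariant :: "'n cpoly \<Rightarrow> bool" where
  "minimal_invariant f \<longleftrightarrow> f \<in> invs UNIV \<and> mdeg f > 0 \<and>
     (\<forall>g\<in>invs UNIV. mdeg g > 0 \<longrightarrow> mdeg f \<le> mdeg g)"

lemma minimal_invariant_exists: "\<exists>f. minimal_invariant f"
proof -
  obtain f0 where "f0 \<in> invs UNIV \<and> mdeg f0 > 0" using nonconst_invariant_exists by blast
  from ex_has_least_nat[of "\<lambda>f. f \<in> invs UNIV \<and> mdeg f > 0", OF this, of mdeg]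
  show ?thesis by (auto simp: minimal_invariant_def)
qed

lemma free_zero_of_prime_exists: "prime_elem q \<Longrightarrow> \<exists>x. ev q x = 0 \<and> free_at \<phi> x"
proof (rule ccontr)
  assume q: "prime_elem q" and "\<not> (\<exists>x. ev q x = 0 \<and> free_at \<phi> x)"
  then have "zeros q \<subseteq> NL \<phi>" by (auto simp: zeros_def NL_def)
  from codim_zeros_le_1[OF q this] have "(2::enat) \<le> 1" using codim_NL by (rule order_trans[rotated])
  then show False by (simp add: one_enat_def numeral_eq_enat)
qed

text \<open>A prime factor \<open>q\<close> of \<open>f - c\<close> is an invariant, so its degree is at least that of \<open>f\<close>, and the
  cofactor is constant. For \<open>x\<close> on \<open>q = 0\<close> where the action is free, the orbit carries \<open>n - 1\<close>
  independent functions, hence its ideal is generated by \<open>q\<close>.\<close>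

lemma fibre_equation_generates_orbit_ideal:
  assumes f: "minimal_invariant f"
  shows "\<exists>x. ev f x = c \<and> free_at \<phi> x \<and> (\<forall>h. vanish (orbit \<phi> x) h \<longrightarrow> f - cst c dvd h)"
proof -
  have finv: "f \<in> invs UNIV" and fpos: "mdeg f > 0" using f by (auto simp: minimal_invariant_def)
  have fc: "f - cst c \<in> invs UNIV" using finv by auto
  have fc_pos: "mdeg (f - cst c) > 0"
  proof (rule ccontr)
    assume "\<not> mdeg (f - cst c) > 0"
    then obtain d where "f - cst c = cst d" by (auto simp: mdeg_eq_0_iff)
    then have "f = cst (c + d)" by (simp add: cst_simps algebra_simps)
    then show False using fpos mdeg_eq_0_iff[of f] by simp
  qed
  then obtain q where q: "prime_elem q" "q dvd f - cst c" using prime_factor_exists_cpoly by blast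
  then obtain z where z: "f - cst c = q * z" by (auto elim: dvdE)
  have nz: "q * z \<noteq> 0" using fc_pos z by (metis cst_eq_iff(2) less_numeral_extra(3) mdeg_eq_0_iff)
  then have "q \<in> invs UNIV" using invs_factorially_closed(1)[of q z UNIV] fc z by simp
  then have "mdeg f \<le> mdeg q" using f mdeg_prime[OF q(1)] by (auto simp: minimal_invariant_def)
  moreover have "mdeg q + mdeg z \<le> mdeg f"
    using mdeg_diff_cst[of f c] nz by (simp add: z mdeg_mult)
  ultimately have "z dvd 1" using nz by (simp add: is_unit_cpoly_iff)
  then have fc_q: "f - cst c dvd q"
    using dvd_unit_cofactor[of "f - cst c" z q] z by (simp add: mult.commute)
  obtain x where x: "ev q x = 0" "free_at \<phi> x" using free_zero_of_prime_exists[OF q(1)] by blast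
  have "ev (f - cst c) x = 0" using x z by simp
  then have fx: "ev f x = c" by simp
  have "vanish (orbit \<phi> x) q"
    using x(1) invs_UNIV_act[OF \<open>q \<in> invs UNIV\<close>] by (auto simp: vanish_def orbit_def)
  moreover obtain F where "alg_indep_on (orbit \<phi> x) CARD('p) F" using free_at_alg_indep[OF x(2)] by blast
  ultimately have "q dvd h" if "vanish (orbit \<phi> x) h" for h
    using dvd_if_vanishes_on_hypersurface that q(1) card_n by metis
  then show ?thesis using fx x(2) fc_q by (metis dvd_trans)
qed

lemma minimal_invariant_generates:
  assumes f: "minimal_invariant f" and "h \<in> invs UNIV"
  shows "\<exists>p. h = comp_poly p f"
  using assms(2)
proof (induction "mdeg h" arbitrary: h rule: less_induct)
  case less
  show ?case
  proof (cases "mdeg h = 0")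
    case True
    then obtain c where "h = cst c" by (auto simp: mdeg_eq_0_iff)
    then show ?thesis by (intro exI[of _ "[:c:]"]) (simp add: comp_poly_pCons)
  next
    case False
    obtain x where x: "\<And>g. vanish (orbit \<phi> x) g \<Longrightarrow> f dvd g"
      using fibre_equation_generates_orbit_ideal[OF f, of 0] by (auto simp: cst_simps)
    let ?c = "ev h x"
    have "vanish (orbit \<phi> x) (h - cst ?c)"
      using invs_UNIV_act[OF less.prems] by (auto simp: vanish_def orbit_def)
    then obtain z where z: "h - cst ?c = f * z" using x by (auto elim: dvdE)
    have "h \<noteq> cst ?c" using False mdeg_eq_0_iff[of h] by metis
    then have nz: "f * z \<noteq> 0" using z by (metis eq_iff_diff_eq_0)
    have "h - cst ?c \<in> invs UNIV" using less.prems by auto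
    then have "z \<in> invs UNIV" using invs_factorially_closed(2)[of f z UNIV] nz z by simp
    moreover have "mdeg f + mdeg z \<le> mdeg h"
      using mdeg_diff_cst[of h ?c] nz by (simp add: z mdeg_mult)
    then have "mdeg z < mdeg h" using f by (auto simp: minimal_invariant_def)
    ultimately obtain p where "z = comp_poly p f" using less.hyps by blast
    then have "h = comp_poly (pCons ?c p) f"
      using z by (simp add: comp_poly_pCons algebra_simps)
    then show ?thesis by blast
  qed
qed

text \<open>Otherwise the \<open>p - 1\<close> axes different from \<open>j\<close> contribute at most \<open>p - 1\<close> vectors and the
  invariants, being polynomials in \<open>f\<close>, only multiples of one gradient; that is fewer than \<open>n\<close>.\<close>

lemma invs_compl_neq_invs_UNIV:
  assumes f: "minimal_invariant f"
  shows "invs (- {j}) \<noteq> invs UNIV"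
proof
  assume eq: "invs (- {j}) = invs UNIV"
  obtain h where h: "h \<noteq> 0" "\<And>x. ev h x \<noteq> 0 \<Longrightarrow> \<exists>T. finite T \<and> card T \<le> card (- {j}) \<and>
     (\<forall>f. grad f x \<in> vec.span ((\<lambda>g. grad g x) ` invs (- {j}) \<union> T))"
    using gradients_spanned[of "- {j}"] by blast
  obtain x where "ev h x \<noteq> 0" using h(1) by (auto simp: cpoly_neq_0_iff)
  with h(2) obtain T where T: "finite T" "card T \<le> card (- {j})"
    "\<And>f. grad f x \<in> vec.span ((\<lambda>g. grad g x) ` invs UNIV \<union> T)" unfolding eq by blast
  let ?T = "insert (grad f x) T"
  have "grad g x \<in> vec.span ?T" if "g \<in> invs UNIV" for g
  proof -
    obtain p where "g = comp_poly p f" using minimal_invariant_generates[OF f \<open>g \<in> invs UNIV\<close>] by blast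
    then have "grad g x \<in> vec.span {grad f x}" using grad_comp_poly_in_span by simp
    then show ?thesis using vec.span_mono[of "{grad f x}" ?T] by auto
  qed
  then have "(\<lambda>g. grad g x) ` invs UNIV \<union> T \<subseteq> vec.span ?T"
    using vec.span_base[of _ ?T] by blast
  then have "vec.span ((\<lambda>g. grad g x) ` invs UNIV \<union> T) \<subseteq> vec.span ?T"
    by (rule vec.span_minimal) (rule vec.subspace_span)
  then have "CARD('n) \<le> card ?T" using gradients_span_card[of x ?T] T by blast
  also have "\<dots> \<le> Suc (card (- {j}))" using T by (simp add: card_insert_if)
  also have "card (- {j}) = CARD('p) - 1" by (simp add: card_Diff_singleton Compl_eq_Diff_UNIV)
  finally show False using card_n zero_less_card_finite[where 'a = 'p] by linarith
qed

text \<open>Among the local slices moving to \<open>s + t p(f)\<close>, one with \<open>p\<close> of least degree has \<open>p\<close> constant: at a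
  root \<open>c\<close> of \<open>p\<close>, the function \<open>s\<close> is constant on an orbit whose ideal is generated by \<open>f - c\<close>, and the
  quotient of \<open>s - s(x)\<close> by \<open>f - c\<close> is a local slice with \<open>p\<close> divided by its linear factor.\<close>

lemma slice_exists:
  assumes f: "minimal_invariant f"
  shows "\<exists>s. \<forall>u x. ev s (\<phi> u x) = ev s x + u $ j"
proof -
  have UN: "insert j (- {j}) = UNIV" by auto
  have finv: "f \<in> invs UNIV" using f by (simp add: minimal_invariant_def)
  let ?P = "\<lambda>(s, p). s \<in> invs (- {j}) \<and> p \<noteq> 0 \<and> flow j s = [:s, comp_poly p f:]"
  have "\<exists>sp. ?P sp"
  proof -
    obtain s a where sa: "s \<in> invs (- {j})" "a \<in> invs UNIV" "a \<noteq> 0" "flow j s = [:s, a:]"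
      using local_slice_exists[of j "- {j}"] invs_compl_neq_invs_UNIV[OF f, of j] unfolding UN by metis
    then obtain p where "a = comp_poly p f" using minimal_invariant_generates[OF f] by blast
    with sa show ?thesis by (intro exI[of _ "(s, p)"]) auto
  qed
  then obtain sp0 where "?P sp0" by blast
  from ex_has_least_nat[of ?P, OF this, of "\<lambda>sp. degree (snd sp)"]
  obtain s p where s: "s \<in> invs (- {j})" "p \<noteq> 0" "flow j s = [:s, comp_poly p f:]"
    and min: "\<And>s' p'. s' \<in> invs (- {j}) \<Longrightarrow> p' \<noteq> 0 \<Longrightarrow> flow j s' = [:s', comp_poly p' f:] \<Longrightarrow>
      degree p \<le> degree p'" by auto
  have shift: "ev s (\<phi> u x) = ev s x + u $ j * poly p (ev f x)" for u x
  proof (rule act_shift)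
    show "ev s (\<phi> (axis i t) x) = ev s x + (if i = j then t * poly p (ev f x) else 0)" for i t x
    proof (cases "i = j")
      case True
      then show ?thesis using s(3) by (simp add: ev_flow)
    next
      case False
      then show ?thesis using s(1) by (simp add: invs_iff)
    qed
    show "poly p (ev f (\<phi> u x)) = poly p (ev f x)" for u x
      by (simp add: invs_UNIV_act[OF finv])
  qed
  have "degree p = 0"
  proof (rule ccontr)
    assume "degree p \<noteq> 0"
    then have "\<not> constant (poly p)" by (simp add: constant_degree)
    then obtain c where "poly p c = 0" using fundamental_theorem_of_algebra by blast
    then obtain p' where p': "p = [:- c, 1:] * p'" by (auto simp: poly_eq_0_iff_dvd elim: dvdE)
    have p'0: "p' \<noteq> 0" using p' s(2) by auto
    have fc: "f - cst c \<noteq> 0"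
    proof
      assume "f - cst c = 0"
      then have "f = cst c" by simp
      then show False using f mdeg_eq_0_iff[of f] by (auto simp: minimal_invariant_def)
    qed
    obtain x where x: "ev f x = c" "\<And>g. vanish (orbit \<phi> x) g \<Longrightarrow> f - cst c dvd g"
      using fibre_equation_generates_orbit_ideal[OF f, of c] by blast
    have "vanish (orbit \<phi> x) (s - cst (ev s x))"
      using \<open>poly p c = 0\<close> x(1) by (auto simp: vanish_def orbit_def shift)
    then obtain z where z: "s - cst (ev s x) = (f - cst c) * z" using x(2) by (auto elim: dvdE)
    have "z \<in> invs (- {j})"
    proof (cases "z = 0")
      case True
      then show ?thesis using invs_closed(4)[of 0] by (simp add: cst_simps)
    next
      case False
      have "s - cst (ev s x) \<in> invs (- {j})" using s(1) by auto
      then show ?thesis using invs_factorially_closed(2)[of "f - cst c" z] z fc False by simp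
    qed
    moreover have "flow j z = [:z, comp_poly p' f:]"
    proof -
      have flow_fc: "flow j (f - cst c) = [:f - cst c:]"
        using finv by (simp add: flow_simps invs_def)
      have comp: "comp_poly p f = (f - cst c) * comp_poly p' f"
        by (rule cpoly_eqI) (simp add: p' algebra_simps)
      have "flow j ((f - cst c) * z) = [:s, comp_poly p f:] - [:cst (ev s x):]"
        unfolding z[symmetric] flow_simps s(3) ..
      also have "\<dots> = [:f - cst c:] * [:z, comp_poly p' f:]"
        using z by (simp add: comp)
      finally have "[:f - cst c:] * flow j z = [:f - cst c:] * [:z, comp_poly p' f:]"
        by (simp only: flow_simps(3) flow_fc)
      moreover have "[:f - cst c:] \<noteq> 0" using fc by simp
      ultimately show ?thesis by (metis mult_left_cancel)
    qed
    ultimately have "degree p \<le> degree p'" using min p'0 by blast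
    moreover have "degree p = Suc (degree p')"
      unfolding p' using p'0 by (subst degree_mult_eq) auto
    ultimately show False by simp
  qed
  then obtain k where k: "p = [:k:]" by (metis degree_eq_zeroE)
  then have "k \<noteq> 0" using s(2) by simp
  then show ?thesis
    by (intro exI[of _ "cst (1 / k) * s"]) (simp add: shift k field_simps)
qed

text \<open>The curve \<open>\<gamma>\<close> parametrises the points with all \<open>s_j = 0\<close>, one on each orbit. Moving \<open>x\<close> by
  \<open>- s(x)\<close> leads to this curve at a point that depends on the orbit only, so its coordinates are
  invariants and hence polynomials in \<open>f\<close>.\<close>

theorem trivialising_coordinates:
  obtains s f \<gamma> where
    "\<And>j u x. ev (s j) (\<phi> u x) = ev (s j) x + u $ j" "\<And>u x. ev f (\<phi> u x) = ev f x"
    "\<And>x. \<phi> (\<chi> j. ev (s j) x) (\<chi> i. poly (\<gamma> i) (ev f x)) = x"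
    "\<And>j c. ev (s j) (\<chi> i. poly (\<gamma> i) c) = 0" "\<And>c. ev f (\<chi> i. poly (\<gamma> i) c) = c"
    "\<And>c. \<exists>x. ev f x = c \<and> free_at \<phi> x"
proof -
  obtain f where f: "minimal_invariant f" using minimal_invariant_exists by blast
  then have f_act: "ev f (\<phi> u x) = ev f x" for u x by (auto simp: minimal_invariant_def invs_UNIV_act)
  have "\<forall>j. \<exists>s. \<forall>u x. ev s (\<phi> u x) = ev s x + u $ j" using slice_exists[OF f] by blast
  then obtain s where s: "\<And>j u x. ev (s j) (\<phi> u x) = ev (s j) x + u $ j" by metis
  define \<rho> where "\<rho> x = \<phi> (\<chi> j. - ev (s j) x) x" for x
  have \<rho>_act: "\<rho> (\<phi> u x) = \<rho> x" for u x
  proof -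
    have "(\<chi> j. - ev (s j) (\<phi> u x)) + u = (\<chi> j. - ev (s j) x)" by (simp add: s vec_eq_iff)
    then show ?thesis by (simp add: \<rho>_def act_add)
  qed
  have "\<exists>p. \<forall>x. \<rho> x $ i = poly p (ev f x)" for i
  proof -
    have "cpoly_fun (\<lambda>x. \<rho> x $ i)" unfolding \<rho>_def
    proof (rule cpoly_fun_act_compose)
      show "cpoly_fun (\<lambda>x. (\<chi> j. - ev (s j) x) $ j)" for j
        by (rule cpoly_funI[of "- s j"]) simp
    qed (auto intro: cpoly_fun.coord)
    then obtain r where r: "ev r = (\<lambda>x. \<rho> x $ i)" using cpoly_of_fun by blast
    then have "r \<in> invs UNIV" by (simp add: invs_iff \<rho>_act)
    then obtain p where "r = comp_poly p f" using minimal_invariant_generates[OF f] by blast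
    then have "ev r x = poly p (ev f x)" for x by simp
    then show ?thesis using r by (intro exI[of _ p]) simp
  qed
  then obtain \<gamma> where "\<And>i x. \<rho> x $ i = poly (\<gamma> i) (ev f x)" by metis
  then have \<rho>_eq: "\<rho> x = (\<chi> i. poly (\<gamma> i) (ev f x))" for x by (simp add: vec_eq_iff)
  have free: "\<exists>x. ev f x = c \<and> free_at \<phi> x" for c using fibre_equation_generates_orbit_ideal[OF f, of c] by blast
  show thesis
  proof (rule that[OF s f_act _ _ _ free])
    fix x
    have "(\<chi> j. ev (s j) x) + (\<chi> j. - ev (s j) x) = 0" by (simp add: vec_eq_iff)
    then show "\<phi> (\<chi> j. ev (s j) x) (\<chi> i. poly (\<gamma> i) (ev f x)) = x"
      unfolding \<rho>_eq[symmetric] by (simp add: \<rho>_def act_add)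
  next
    fix j c
    obtain x where "ev f x = c" using free by blast
    then have "(\<chi> i. poly (\<gamma> i) c) = \<rho> x" by (simp add: \<rho>_eq)
    then show "ev (s j) (\<chi> i. poly (\<gamma> i) c) = 0" by (simp add: \<rho>_def s)
  next
    fix c
    obtain x where x: "ev f x = c" using free by blast
    then have "(\<chi> i. poly (\<gamma> i) c) = \<rho> x" by (simp add: \<rho>_eq)
    then show "ev f (\<chi> i. poly (\<gamma> i) c) = c" by (simp add: \<rho>_def f_act x)
  qed
qed

end

theorem corollary1p10:
  fixes \<phi> :: "complex^'p \<Rightarrow> complex^'n \<Rightarrow> complex^'n"
    and \<iota> :: "'p \<Rightarrow> 'n"
  assumes "CARD('n) \<ge> 2"
    and "CARD('p) = CARD('n) - 1"
    and "inj \<iota>"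
    and "algebraic_action \<phi>"
    and "codim zariski (NL \<phi>) \<ge> 2"
  shows "trivial_action \<iota> \<phi> \<and> free_action \<phi>"
proof -
  interpret almost_free_action \<phi>
    using assms by unfold_locales auto
  obtain s f \<gamma> where
    s: "\<And>j u x. ev (s j) (\<phi> u x) = ev (s j) x + u $ j" and f: "\<And>u x. ev f (\<phi> u x) = ev f x"
    and sect: "\<And>x. \<phi> (\<chi> j. ev (s j) x) (\<chi> i. poly (\<gamma> i) (ev f x)) = x"
    and s0: "\<And>j c. ev (s j) (\<chi> i. poly (\<gamma> i) c) = 0" and f0: "\<And>c. ev f (\<chi> i. poly (\<gamma> i) c) = c"
    and free: "\<And>c. \<exists>x. ev f x = c \<and> free_at \<phi> x"
    by (rule trivialising_coordinates) blast
  have "card (- range \<iota>) = 1"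
    using assms(1,2) card_image[OF assms(3)] by (simp add: Compl_eq_Diff_UNIV card_Diff_subset)
  then obtain k0 where k0: "- range \<iota> = {k0}" by (auto simp: card_1_singleton_iff)
  then have range_iff: "k \<in> range \<iota> \<longleftrightarrow> k \<noteq> k0" for k by auto
  \<comment> \<open>the slices in the coordinates that are to be translated, and \<open>f\<close> in the remaining one\<close>
  define \<psi> where "\<psi> x = (\<chi> k. if k \<in> range \<iota> then ev (s (inv \<iota> k)) x else ev f x)" for x
  define \<theta> where "\<theta> y = \<phi> (\<chi> j. y $ \<iota> j) (\<chi> i. poly (\<gamma> i) (y $ k0))" for y
  have inv_\<iota>: "inv \<iota> (\<iota> j) = j" for j using assms(3) by simp
  have \<iota>_k0: "\<iota> j \<noteq> k0" for j using range_iff by auto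
  have left: "\<theta> (\<psi> x) = x" for x
    using sect[of x] by (simp add: \<theta>_def \<psi>_def inv_\<iota> range_iff \<iota>_k0)
  have right: "\<psi> (\<theta> y) = y" for y
  proof -
    have "\<psi> (\<theta> y) $ k = y $ k" for k
    proof (cases "k = k0")
      case True
      then show ?thesis by (simp add: \<psi>_def \<theta>_def range_iff f f0)
    next
      case False
      then obtain j where "k = \<iota> j" using range_iff by auto
      then show ?thesis by (simp add: \<psi>_def \<theta>_def s s0 inv_\<iota>)
    qed
    then show ?thesis by (simp add: vec_eq_iff)
  qed
  have "cpoly_map \<psi>"
    unfolding cpoly_map_def
  proof
    fix k show "cpoly_fun (\<lambda>x. \<psi> x $ k)"
      by (cases "k \<in> range \<iota>") (simp_all add: \<psi>_def)
  qed
  moreover have "cpoly_map \<theta>"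
    unfolding cpoly_map_def
  proof
    fix k
    have "cpoly_fun (\<lambda>y. poly (\<gamma> i) (y $ k0))" for i
      by (rule cpoly_funI[of "comp_poly (\<gamma> i) (var k0)"]) simp
    then show "cpoly_fun (\<lambda>y. \<theta> y $ k)"
      unfolding \<theta>_def by (intro cpoly_fun_act_compose) (auto intro: cpoly_fun.coord)
  qed
  moreover have "bij \<psi>" by (rule o_bij[of \<theta>]) (auto simp: left right fun_eq_iff)
  moreover have "inv \<psi> = \<theta>" by (rule inv_equality) (auto simp: left right)
  ultimately have "cpoly_automorphism \<psi>" by (simp add: cpoly_automorphism_def)
  moreover have "\<psi> (\<phi> t x) = translation_action \<iota> t (\<psi> x)" for t x
    by (auto simp: \<psi>_def translation_action_def vec_eq_iff s f)
  ultimately have "trivial_action \<iota> \<phi>" unfolding trivial_action_def by blast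
  moreover have "free_at \<phi> x" for x
  proof -
    obtain y where y: "ev f y = ev f x" "free_at \<phi> y" using free by blast
    let ?z = "\<chi> i. poly (\<gamma> i) (ev f x)"
    have orb: "orbit \<phi> (\<phi> u z) = orbit \<phi> z" for u z
    proof -
      have "\<phi> t z = \<phi> (t - u) (\<phi> u z)" for t by (simp add: act_add)
      then show ?thesis unfolding orbit_def by (auto simp: act_add image_iff) (metis diff_add_cancel)
    qed
    have "orbit \<phi> x = orbit \<phi> ?z" "orbit \<phi> y = orbit \<phi> ?z"
      using orb sect[of x] sect[of y] unfolding y(1) by metis+
    then show ?thesis using y(2) by (simp add: free_at_def)
  qed
  ultimately show ?thesis by (simp add: free_action_def)
qed

end
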